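(* Let $f_1,f_2\in C^2(\mathbb{R})$ and suppose that there are constants $C_1,C_2>0$ and exponents $\mu_1,\mu_2>1$ such that for $i=1,2$ $$0<f_i''(t)\le C_i(1+t^2)^{-\mu_i/2}\quad\text{for all } t\in\mathbb{R}.$$ Let $f(p_1,p_2):=f_1(p_1)+f_2(p_2)$ for $(p_1,p_2)\in\mathbb{R}^2$, and let $u\in C^2(\mathbb{R}^2)$ be a solution of $$\operatorname{div}\big(Df(\nabla u)\big)=0\quad\text{on } \mathbb{R}^2 .$$ If $u$ is $\mu$-balanced with $\mu=(\mu_1,\mu_2)$, then $u$ is an affine function.
   Context: The equation $\operatorname{div}(Df(\nabla u))=0$ reads $f_1''(\partial_1u)\,\partial_{11}u+f_2''(\partial_2u)\,\partial_{22}u=0$. Definition. Let $\mu=(\mu_1,\mu_2)$ with numbers $\mu_i>1$, $i=1,2$. A function $u\in C^1(\mathbb{R}^2)$ is called $\mu$-balanced if there exist a constant $c>0$ and a number $\rho>0$ such that at least one of the following holds: (i) $\rho\in(1/\mu_2,1)$ and $|\partial_1u|\le c\,\big(|\partial_2u|^{\rho\mu_2}+1\big)$ on $\mathbb{R}^2$; (ii) $\rho\in(1/\mu_1,1)$ and $|\partial_2u|\le c\,\big(|\partial_1u|^{\rho\mu_1}+1\big)$ on $\mathbb{R}^2$. *)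

theory Defs
  imports "HOL-Analysis.Analysis"
begin

text \<open>
  Functions of class $C^k$ on the whole space. The domain type covers both \<^typ>\<open>real\<close>
  (where \<^term>\<open>Basis\<close> is \<^term>\<open>{1}\<close>) and \<^typ>\<open>real ^ 2\<close>. Frechet
  differentiability is required at each step; it is automatic once the first partial
  derivatives exist and are continuous, so this is the usual notion.
\<close>

primrec C_k :: "nat \<Rightarrow> ('a::euclidean_space \<Rightarrow> real) \<Rightarrow> bool" where
  "C_k 0 g \<longleftrightarrow> continuous_on UNIV g"
| "C_k (Suc k) g \<longleftrightarrow>
     (\<forall>x. g differentiable (at x)) \<and>
     (\<forall>b\<in>Basis. C_k k (\<lambda>x. frechet_derivative g (at x) b))"

definition partial_deriv :: "'n::finite \<Rightarrow> (real ^ 'n \<Rightarrow> real) \<Rightarrow> real ^ 'n \<Rightarrow> real" where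
  "partial_deriv i g x = frechet_derivative g (at x) (axis i 1)"

definition grad :: "(real ^ 'n \<Rightarrow> real) \<Rightarrow> real ^ 'n \<Rightarrow> real ^ 'n::finite" where
  "grad g x = (\<chi> i. partial_deriv i g x)"

definition divergence :: "(real ^ 'n \<Rightarrow> real ^ 'n) \<Rightarrow> real ^ 'n::finite \<Rightarrow> real" where
  "divergence F x = (\<Sum>i\<in>UNIV. partial_deriv i (\<lambda>y. F y $ i) x)"

definition balanced :: "real \<Rightarrow> real \<Rightarrow> (real ^ 2 \<Rightarrow> real) \<Rightarrow> bool" where
  "balanced \<mu>1 \<mu>2 u \<longleftrightarrow>
     \<mu>1 > 1 \<and> \<mu>2 > 1 \<and> C_k 1 u \<and>
     (\<exists>c>0. \<exists>\<rho>>0.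
        (\<rho> \<in> {1 / \<mu>2<..<1} \<and>
           (\<forall>x. \<bar>partial_deriv 1 u x\<bar> \<le> c * (\<bar>partial_deriv 2 u x\<bar> powr (\<rho> * \<mu>2) + 1))) \<or>
        (\<rho> \<in> {1 / \<mu>1<..<1} \<and>
           (\<forall>x. \<bar>partial_deriv 2 u x\<bar> \<le> c * (\<bar>partial_deriv 1 u x\<bar> powr (\<rho> * \<mu>1) + 1))))"

end

theory Submission
  imports Defs
begin

text \<open>
  In case (i) of the balancing condition put \<open>w = \<partial>\<^sub>1u\<close>, \<open>\<alpha> = f\<^sub>1''(\<partial>\<^sub>1u)\<close>, \<open>\<beta> = f\<^sub>2''(\<partial>\<^sub>2u)\<close>; case (ii) follows by
  exchanging the coordinates. Differentiating the equation in direction 1 shows that \<open>w\<close> solves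
  \<open>\<partial>\<^sub>1(\<alpha> \<partial>\<^sub>1w) + \<partial>\<^sub>2(\<beta> \<partial>\<^sub>2w) = 0\<close> weakly: since \<open>(\<alpha> \<partial>\<^sub>1w, \<beta> \<partial>\<^sub>2w)\<close> is the rotated gradient of
  \<open>f\<^sub>2'(\<partial>\<^sub>2u)\<close>, this says that a Jacobian integrates to zero. Choose \<open>s > 1\<close> with \<open>s \<le> \<mu>\<^sub>1\<close> and \<open>\<rho> s \<le> 1\<close>. The growth
  bounds and the balancing condition make \<open>\<alpha> (1 + w\<^sup>2)\<^bsup>s/2\<^esup>\<close> and \<open>\<beta> (1 + w\<^sup>2)\<^bsup>s/2\<^esup>\<close> bounded. Test with
  \<open>\<eta>\<^sup>2 g(w)\<close>, where \<open>g(t) = t (1 + t\<^sup>2)\<^bsup>s/2-1\<^esup>\<close> satisfies \<open>g\<^sup>2 \<le> (1 + t\<^sup>2)\<^bsup>s/2\<^esup> g' / (s - 1)\<close>: the energy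
  \<open>\<integral> \<eta>\<^sup>2 g'(w) (\<alpha> (\<partial>\<^sub>1w)\<^sup>2 + \<beta> (\<partial>\<^sub>2w)\<^sup>2)\<close> is controlled by \<open>\<integral> |\<nabla>\<eta>|\<^sup>2\<close>, which in the plane stays bounded for
  cutoffs at scale \<open>n \<rightarrow> \<infinity>\<close>. So the total energy is finite, and as \<open>\<nabla>\<eta>\<close> lives on \<open>|x| \<ge> n\<close> it is even zero.
  Hence \<open>\<nabla>\<partial>\<^sub>1u = 0\<close>, and the equation leaves \<open>\<partial>\<^sub>2\<^sub>2u = 0\<close>.
\<close>

section \<open>Continuously differentiable functions\<close>

text \<open>The derivative is carried explicitly as a function of point and direction, so that
  products and compositions come with formulas that can be integrated. Continuity is asked for each
  fixed direction; in finite dimension this amounts to continuity of the derivative as a linear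
  map.\<close>

definition has_C1_derivative ::
    "('a::euclidean_space \<Rightarrow> real) \<Rightarrow> ('a \<Rightarrow> 'a \<Rightarrow> real) \<Rightarrow> bool" where
  "has_C1_derivative F F' \<longleftrightarrow>
     (\<forall>x. (F has_derivative F' x) (at x)) \<and> (\<forall>v. continuous_on UNIV (\<lambda>x. F' x v))"

lemma has_C1_derivativeD:
  assumes "has_C1_derivative F F'"
  shows "(F has_derivative F' x) (at x)" and "continuous_on UNIV (\<lambda>x. F' x v)"
  using assms by (auto simp: has_C1_derivative_def)

lemma has_C1_derivative_continuous:
  assumes "has_C1_derivative F F'"
  shows "continuous_on UNIV F"
  using has_C1_derivativeD(1)[OF assms] has_derivative_continuous
  by (force simp: continuous_on_eq_continuous_at)

lemma has_C1_derivative_bounded_linear: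
  assumes "has_C1_derivative F F'"
  shows "bounded_linear (F' x)"
  using has_C1_derivativeD(1)[OF assms] has_derivative_bounded_linear by blast

lemma has_C1_derivative_mult:
  assumes F: "has_C1_derivative F F'" and G: "has_C1_derivative G G'"
  shows "has_C1_derivative (\<lambda>x. F x * G x) (\<lambda>x v. F x * G' x v + F' x v * G x)"
  unfolding has_C1_derivative_def
  by (intro conjI allI has_derivative_mult continuous_intros has_C1_derivativeD[OF F]
      has_C1_derivativeD[OF G] has_C1_derivative_continuous[OF F] has_C1_derivative_continuous[OF G])

lemma has_C1_derivative_compose:
  fixes g g' :: "real \<Rightarrow> real"
  assumes F: "has_C1_derivative F F'"
    and g: "\<And>t. (g has_real_derivative g' t) (at t)" and g': "continuous_on UNIV g'"
  shows "has_C1_derivative (\<lambda>x. g (F x)) (\<lambda>x v. g' (F x) * F' x v)"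
  unfolding has_C1_derivative_def
proof (intro conjI allI)
  fix x
  have "(g has_derivative (\<lambda>t. g' (F x) * t)) (at (F x))"
    using g[of "F x"] by (simp add: has_field_derivative_def)
  from diff_chain_at[OF has_C1_derivativeD(1)[OF F] this]
  show "((\<lambda>x. g (F x)) has_derivative (\<lambda>v. g' (F x) * F' x v)) (at x)"
    by (simp add: o_def)
next
  fix v
  have "continuous_on UNIV (\<lambda>x. g' (F x))"
    using continuous_on_compose2[OF g' has_C1_derivative_continuous[OF F]] by simp
  then show "continuous_on UNIV (\<lambda>x. g' (F x) * F' x v)"
    by (intro continuous_intros has_C1_derivativeD[OF F])
qed

lemma has_C1_derivative_line:
  assumes "has_C1_derivative F F'"
  shows "((\<lambda>t. F (x + t *\<^sub>R v)) has_real_derivative F' (x + t *\<^sub>R v) v) (at t)"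
proof -
  have "((\<lambda>t. x + t *\<^sub>R v) has_derivative (\<lambda>h. h *\<^sub>R v)) (at t)"
    by (auto intro!: derivative_eq_intros)
  from diff_chain_at[OF this has_C1_derivativeD(1)[OF assms]]
  have "((\<lambda>t. F (x + t *\<^sub>R v)) has_derivative (\<lambda>h. F' (x + t *\<^sub>R v) (h *\<^sub>R v))) (at t)"
    by (simp add: o_def)
  moreover have "F' (x + t *\<^sub>R v) (h *\<^sub>R v) = F' (x + t *\<^sub>R v) v * h" for h
    using linear_cmul[OF bounded_linear.linear[OF has_C1_derivative_bounded_linear[OF assms]]]
    by simp
  ultimately show ?thesis
    by (simp add: has_field_derivative_def)
qed

lemma has_C1_derivative_const_vanishes:
  assumes "has_C1_derivative F F'" and "open S" and "x \<in> S" and "\<And>y. y \<in> S \<Longrightarrow> F y = k"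
  shows "F' x v = 0"
proof -
  have "(F has_derivative (\<lambda>v. 0)) (at x)"
    by (rule has_derivative_transform_within_open[OF has_derivative_const assms(2,3)])
      (simp add: assms(4))
  then show ?thesis
    using has_derivative_unique[OF has_C1_derivativeD(1)[OF assms(1)]] by metis
qed

section \<open>Symmetry of second derivatives\<close>

lemma second_difference_mean_value:
  assumes u: "has_C1_derivative u u'" and ua: "has_C1_derivative (\<lambda>x. u' x a) D" and h: "0 < h"
  obtains y where "norm (y - x) \<le> h * (norm a + norm b)"
    "u (x + h *\<^sub>R a + h *\<^sub>R b) - u (x + h *\<^sub>R a) - u (x + h *\<^sub>R b) + u x = h\<^sup>2 * D y b"
proof -
  \<comment> \<open>The mean value theorem is used twice: along \<open>a\<close> for the increment
    \<open>g\<close> of \<open>u\<close> over \<open>h *\<^sub>R b\<close>, then along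
    \<open>b\<close> for the derivative of \<open>u\<close> in direction \<open>a\<close>.\<close>
  define g where "g t = u (x + h *\<^sub>R b + t *\<^sub>R a) - u (x + t *\<^sub>R a)" for t
  have "(g has_real_derivative u' (x + h *\<^sub>R b + t *\<^sub>R a) a - u' (x + t *\<^sub>R a) a) (at t)" for t
    unfolding g_def by (intro DERIV_diff has_C1_derivative_line[OF u])
  from MVT2[OF h this] obtain p where p: "0 < p" "p < h"
    "g h - g 0 = h * (u' (x + h *\<^sub>R b + p *\<^sub>R a) a - u' (x + p *\<^sub>R a) a)" by auto
  have "((\<lambda>t. u' (x + p *\<^sub>R a + t *\<^sub>R b) a) has_real_derivative D (x + p *\<^sub>R a + t *\<^sub>R b) b) (at t)" for t
    by (rule has_C1_derivative_line[OF ua])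
  from MVT2[OF h this] obtain q where q: "0 < q" "q < h"
    "u' (x + p *\<^sub>R a + h *\<^sub>R b) a - u' (x + p *\<^sub>R a) a = h * D (x + p *\<^sub>R a + q *\<^sub>R b) b" by auto
  have "norm (p *\<^sub>R a + q *\<^sub>R b) \<le> h * norm a + h * norm b"
    using p(1,2) q(1,2) by (intro norm_triangle_le add_mono) (auto simp: mult_right_mono)
  then have "norm (x + p *\<^sub>R a + q *\<^sub>R b - x) \<le> h * (norm a + norm b)"
    by (simp add: distrib_left add.assoc)
  moreover have "g h - g 0 = h\<^sup>2 * D (x + p *\<^sub>R a + q *\<^sub>R b) b"
    using p(3) q(3) by (simp add: add_ac power2_eq_square)
  then have "u (x + h *\<^sub>R a + h *\<^sub>R b) - u (x + h *\<^sub>R a) - u (x + h *\<^sub>R b) + u x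
      = h\<^sup>2 * D (x + p *\<^sub>R a + q *\<^sub>R b) b"
    by (simp add: g_def add_ac)
  ultimately show ?thesis by (rule that)
qed

text \<open>The second difference of \<open>u\<close> does not change when \<open>a\<close> and
  \<open>b\<close> are exchanged, so it equals \<open>h\<^sup>2\<close> times a value of either
  mixed derivative at a point near \<open>x\<close>. Continuity at \<open>x\<close> then identifies
  the two values up to any \<open>e\<close>.\<close>

lemma mixed_second_derivatives_eq:
  assumes u: "has_C1_derivative u u'"
    and ua: "has_C1_derivative (\<lambda>x. u' x a) Da" and ub: "has_C1_derivative (\<lambda>x. u' x b) Db"
  shows "Da x b = Db x a"
proof -
  define c where "c = norm a + norm b"
  have near: "\<exists>d>0. \<forall>y. norm (y - x) < d \<longrightarrow> \<bar>F y - F x\<bar> < e"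
    if "continuous_on UNIV F" "0 < e" for F :: "'a \<Rightarrow> real" and e
    using that by (simp add: continuous_on_iff dist_norm)
  have "\<bar>Da x b - Db x a\<bar> \<le> 0 + e" if e: "0 < e" for e
  proof -
    obtain d1 where d1: "0 < d1" "\<And>y. norm (y - x) < d1 \<Longrightarrow> \<bar>Da y b - Da x b\<bar> < e / 2"
      using near[OF has_C1_derivativeD(2)[OF ua], of "e / 2" b] e by auto
    obtain d2 where d2: "0 < d2" "\<And>y. norm (y - x) < d2 \<Longrightarrow> \<bar>Db y a - Db x a\<bar> < e / 2"
      using near[OF has_C1_derivativeD(2)[OF ub], of "e / 2" a] e by auto
    \<comment> \<open>Both mean value points lie within \<open>h * c\<close> of \<open>x\<close>;
      the denominator \<open>c + 1\<close> avoids division by zero and puts them strictly inside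
      both radii.\<close>
    define h where "h = min d1 d2 / (c + 1)"
    have c0: "0 \<le> c" by (simp add: c_def)
    have h: "0 < h" using d1(1) d2(1) c0 by (simp add: h_def)
    have "h * (c + 1) = min d1 d2" using c0 by (simp add: h_def)
    then have hc: "h * c < d1" "h * c < d2" using h by (simp_all add: distrib_left)
    obtain y where y: "norm (y - x) \<le> h * (norm a + norm b)"
      "u (x + h *\<^sub>R a + h *\<^sub>R b) - u (x + h *\<^sub>R a) - u (x + h *\<^sub>R b) + u x = h\<^sup>2 * Da y b"
      by (rule second_difference_mean_value[OF u ua h])
    obtain z where z: "norm (z - x) \<le> h * (norm b + norm a)"
      "u (x + h *\<^sub>R b + h *\<^sub>R a) - u (x + h *\<^sub>R b) - u (x + h *\<^sub>R a) + u x = h\<^sup>2 * Db z a"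
      by (rule second_difference_mean_value[OF u ub h])
    have "x + h *\<^sub>R b + h *\<^sub>R a = x + h *\<^sub>R a + h *\<^sub>R b" by (simp add: add_ac)
    then have "h\<^sup>2 * Da y b = h\<^sup>2 * Db z a"
      using y(2) z(2) by (simp only:)
    then have yz: "Da y b = Db z a"
      using h by simp
    have "norm (y - x) < d1" "norm (z - x) < d2"
      using y(1) z(1) hc by (simp_all add: c_def add.commute)
    from d1(2)[OF this(1)] d2(2)[OF this(2)] yz show ?thesis by linarith
  qed
  then have "\<bar>Da x b - Db x a\<bar> \<le> 0" by (rule field_le_epsilon)
  then show ?thesis by simp
qed

section \<open>The integral of a Jacobian\<close>

lemma integrable_continuous_cball_support:
  fixes f :: "'a::euclidean_space \<Rightarrow> real"
  assumes "continuous_on UNIV f" and "\<And>x. norm x > R \<Longrightarrow> f x = 0"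
  shows "integrable lborel f"
proof -
  have "integrable lborel (\<lambda>x. indicator (cball 0 R) x *\<^sub>R f x)"
    by (rule borel_integrable_compact) (use assms(1) continuous_on_subset in auto)
  moreover have "(\<lambda>x. indicator (cball 0 R) x *\<^sub>R f x) = f"
    using assms(2) by (force simp: indicator_def not_le)
  ultimately show ?thesis by simp
qed

section \<open>Translation invariance and difference quotients\<close>

lemma lborel_integral_translate:
  fixes f :: "'a::euclidean_space \<Rightarrow> real"
  assumes "f \<in> borel_measurable borel"
  shows "(\<integral>x. f (c + x) \<partial>lborel) = (\<integral>x. f x \<partial>lborel)"
  using integral_distr[of "(+) c" lborel borel f] assms by (simp add: lborel_distr_plus)

text \<open>At \<open>h = 0\<close> the quotient is 0, so continuity and bounds hold for every step
  without a case distinction in the statements.\<close>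

definition diffquot :: "('a::euclidean_space \<Rightarrow> real) \<Rightarrow> 'a \<Rightarrow> real \<Rightarrow> 'a \<Rightarrow> real" where
  "diffquot F v h x = (F (x + h *\<^sub>R v) - F x) / h"

lemma diffquot_tendsto:
  assumes F: "has_C1_derivative F F'" and "h \<longlonglongrightarrow> 0" and "\<And>n. h n \<noteq> (0::real)"
  shows "(\<lambda>n. diffquot F v (h n) x) \<longlonglongrightarrow> F' x v"
proof -
  have "((\<lambda>t. F (x + t *\<^sub>R v)) has_real_derivative F' x v) (at 0)"
    using has_C1_derivative_line[OF F, of x v 0] by simp
  then have "((\<lambda>h. (F (x + h *\<^sub>R v) - F x) / h) \<longlongrightarrow> F' x v) (at 0)"
    by (simp add: DERIV_def)
  moreover have "filterlim h (at 0) sequentially"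
    using assms(2,3) by (simp add: filterlim_at)
  ultimately show ?thesis
    unfolding diffquot_def by (rule filterlim_compose)
qed

text \<open>The mean value inequality on the segment from \<open>x\<close> to
  \<open>x + h *\<^sub>R v\<close>, which stays in the ball of radius \<open>R + norm v\<close>. The
  bound is uniform in \<open>h\<close> and thus supplies a majorant for dominated
  convergence.\<close>

lemma diffquot_bounded:
  assumes F: "has_C1_derivative F F'"
  obtains L where "0 \<le> L" "\<And>h x. norm x \<le> R \<Longrightarrow> \<bar>h\<bar> \<le> 1 \<Longrightarrow> \<bar>diffquot F v h x\<bar> \<le> L"
proof -
  have "compact ((\<lambda>x. F' x v) ` cball 0 (R + norm v))"
    by (intro compact_continuous_image continuous_on_subset[OF has_C1_derivativeD(2)[OF F]]) auto
  then obtain L where "\<forall>y\<in>(\<lambda>x. F' x v) ` cball 0 (R + norm v). norm y \<le> L"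
    using compact_imp_bounded bounded_iff by metis
  then have L: "\<bar>F' x v\<bar> \<le> L" if "norm x \<le> R + norm v" for x
    using that by simp
  have "\<bar>diffquot F v h x\<bar> \<le> max L 0" if x: "norm x \<le> R" and h: "\<bar>h\<bar> \<le> 1" for x h
  proof (cases "h = 0")
    case False
    have "\<bar>F (x + h *\<^sub>R v) - F (x + 0 *\<^sub>R v)\<bar> \<le> max L 0 * \<bar>h - 0\<bar>"
    proof (rule field_differentiable_bound[of "closed_segment 0 h"
            "\<lambda>t. F (x + t *\<^sub>R v)" "\<lambda>t. F' (x + t *\<^sub>R v) v", simplified real_norm_def])
      fix t assume "t \<in> closed_segment 0 h"
      then have "\<bar>t\<bar> \<le> 1" using h by (auto simp: closed_segment_eq_real_ivl split: if_splits)
      then have "norm (t *\<^sub>R v) \<le> norm v" by (simp add: mult_left_le_one_le)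
      then have "norm (x + t *\<^sub>R v) \<le> R + norm v" using x norm_triangle_mono by blast
      from L[OF this] show "\<bar>F' (x + t *\<^sub>R v) v\<bar> \<le> max L 0" by simp
    qed (auto intro: has_C1_derivative_line[OF F] DERIV_subset)
    then show ?thesis using False by (simp add: diffquot_def divide_simps)
  qed (simp add: diffquot_def)
  then show ?thesis using that[of "max L 0"] by auto
qed

lemma diffquot_continuous:
  assumes "continuous_on UNIV F"
  shows "continuous_on UNIV (diffquot F v h)"
proof -
  have "continuous_on UNIV (\<lambda>x. F (x + h *\<^sub>R v))"
    by (rule continuous_on_compose2[OF assms]) (auto intro!: continuous_intros)
  then show ?thesis
    unfolding diffquot_def by (cases "h = 0") (auto intro!: continuous_intros assms)
qed

text \<open>Dominated convergence: the quotient of \<open>\<psi>\<close> vanishes outside one ball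
  for all steps of size at most 1, and on that ball both quotients are bounded by constants.\<close>

lemma integral_diffquot_tendsto:
  assumes Z: "has_C1_derivative Z Z'" and P: "has_C1_derivative \<psi> \<psi>'"
    and supp: "\<And>x. norm x > R \<Longrightarrow> \<psi> x = 0"
    and h: "h \<longlonglongrightarrow> 0" "\<And>n. h n \<noteq> (0::real)" "\<And>n. \<bar>h n\<bar> \<le> 1"
  shows "(\<lambda>n. \<integral>x. diffquot Z a (h n) x * diffquot \<psi> b (h n) x \<partial>lborel)
           \<longlonglongrightarrow> (\<integral>x. Z' x a * \<psi>' x b \<partial>lborel)"
proof -
  define S where "S = R + norm b"
  have 0: "diffquot \<psi> b (h n) x = 0" if "norm x > S" for n x
  proof -
    have "norm (h n *\<^sub>R b) \<le> norm b" using h(3) by (simp add: mult_left_le_one_le)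
    moreover have "norm x \<le> norm (x + h n *\<^sub>R b) + norm (h n *\<^sub>R b)"
      by (metis add_diff_cancel norm_triangle_ineq4)
    ultimately have "norm (x + h n *\<^sub>R b) > R" using that by (simp add: S_def)
    moreover have "norm x > R" using that norm_ge_zero[of b] unfolding S_def by linarith
    ultimately show ?thesis by (simp add: diffquot_def supp)
  qed
  obtain L where L: "0 \<le> L" "\<And>h x. norm x \<le> S \<Longrightarrow> \<bar>h\<bar> \<le> 1 \<Longrightarrow> \<bar>diffquot Z a h x\<bar> \<le> L"
    using diffquot_bounded[OF Z] by metis
  obtain M where M: "0 \<le> M" "\<And>h x. norm x \<le> S \<Longrightarrow> \<bar>h\<bar> \<le> 1 \<Longrightarrow> \<bar>diffquot \<psi> b h x\<bar> \<le> M"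
    using diffquot_bounded[OF P] by metis
  show ?thesis
  proof (rule integral_dominated_convergence[where w = "\<lambda>x. indicator (cball 0 S) x * (L * M)"])
    show "(\<lambda>x. Z' x a * \<psi>' x b) \<in> borel_measurable lborel"
      using has_C1_derivativeD(2)[OF Z] has_C1_derivativeD(2)[OF P]
      by (auto intro!: borel_measurable_continuous_onI continuous_intros)
    show "(\<lambda>x. diffquot Z a (h n) x * diffquot \<psi> b (h n) x) \<in> borel_measurable lborel" for n
      by (auto intro!: borel_measurable_continuous_onI continuous_on_mult diffquot_continuous
          has_C1_derivative_continuous[OF Z] has_C1_derivative_continuous[OF P])
    show "integrable lborel (\<lambda>x. indicator (cball 0 S) x * (L * M))"
      by (auto intro!: integrable_mult_left emeasure_compact_finite)
    show "AE x in lborel. (\<lambda>n. diffquot Z a (h n) x * diffquot \<psi> b (h n) x) \<longlonglongrightarrow> Z' x a * \<psi>' x b"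
      by (intro always_eventually allI tendsto_mult diffquot_tendsto[OF Z] diffquot_tendsto[OF P] h)
    show "AE x in lborel. norm (diffquot Z a (h n) x * diffquot \<psi> b (h n) x)
            \<le> indicator (cball 0 S) x * (L * M)" for n
    proof (intro always_eventually allI)
      fix x
      show "norm (diffquot Z a (h n) x * diffquot \<psi> b (h n) x) \<le> indicator (cball 0 S) x * (L * M)"
        using 0[of x n] L M h(3)[of n] by (cases "norm x \<le> S") (auto simp: abs_mult intro!: mult_mono)
    qed
  qed
qed

text \<open>Expanding the product gives four integrals of shifted products \<open>T\<close>, and
  translation invariance matches them with those for the step \<open>- h\<close> and exchanged
  directions.\<close>

lemma integral_diffquot_swap:
  fixes Z \<psi> :: "'a::euclidean_space \<Rightarrow> real"
  assumes Z: "continuous_on UNIV Z" and P: "continuous_on UNIV \<psi>"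
    and supp: "\<And>x. norm x > R \<Longrightarrow> \<psi> x = 0"
  shows "(\<integral>x. diffquot Z a h x * diffquot \<psi> b h x \<partial>lborel)
       = (\<integral>x. diffquot Z b (- h) x * diffquot \<psi> a (- h) x \<partial>lborel)"
proof -
  define T where "T p q x = Z (p + x) * \<psi> (q + x)" for p q x :: 'a
  have "continuous_on UNIV (\<lambda>x. Z (p + x))" and "continuous_on UNIV (\<lambda>x. \<psi> (p + x))" for p
    by (rule continuous_on_compose2[OF Z] continuous_on_compose2[OF P];
        auto intro!: continuous_intros)+
  then have cT: "continuous_on UNIV (T p q)" for p q
    unfolding T_def by (intro continuous_on_mult)
  have iT: "integrable lborel (T p q)" for p q
  proof (rule integrable_continuous_cball_support[OF cT])
    fix x :: 'a assume "norm x > R + norm q"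
    moreover have "norm x \<le> norm (q + x) + norm q"
      by (metis add_diff_cancel_left' norm_triangle_ineq4)
    ultimately show "T p q x = 0" using supp[of "q + x"] by (simp add: T_def)
  qed
  have sh: "(\<integral>x. T p q x \<partial>lborel) = (\<integral>x. T (p + c) (q + c) x \<partial>lborel)" for p q c
    using lborel_integral_translate[of "T p q" c] cT[of p q]
    by (simp add: T_def borel_measurable_continuous_onI add.assoc)
  have "(\<integral>x. diffquot Z a h x * diffquot \<psi> b h x \<partial>lborel)
      = (\<integral>x. (T (h *\<^sub>R a) (h *\<^sub>R b) x - T (h *\<^sub>R a) 0 x - T 0 (h *\<^sub>R b) x + T 0 0 x) / (h * h) \<partial>lborel)"
    by (intro Bochner_Integration.integral_cong) (auto simp: diffquot_def T_def field_simps)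
  also have "\<dots> = ((\<integral>x. T (h *\<^sub>R a) (h *\<^sub>R b) x \<partial>lborel) - (\<integral>x. T (h *\<^sub>R a) 0 x \<partial>lborel)
       - (\<integral>x. T 0 (h *\<^sub>R b) x \<partial>lborel) + (\<integral>x. T 0 0 x \<partial>lborel)) / (h * h)"
    by (simp add: iT)
  \<comment> \<open>The term with two shifts is translated by
    \<open>- h *\<^sub>R a - h *\<^sub>R b\<close>, each term with one shift by the opposite of that
    shift.\<close>
  also have "\<dots> = ((\<integral>x. T (- h *\<^sub>R b) (- h *\<^sub>R a) x \<partial>lborel) - (\<integral>x. T 0 (- h *\<^sub>R a) x \<partial>lborel)
       - (\<integral>x. T (- h *\<^sub>R b) 0 x \<partial>lborel) + (\<integral>x. T 0 0 x \<partial>lborel)) / (h * h)"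
    using sh[of "h *\<^sub>R a" "h *\<^sub>R b" "- h *\<^sub>R a - h *\<^sub>R b"] sh[of "h *\<^sub>R a" 0 "- h *\<^sub>R a"]
      sh[of 0 "h *\<^sub>R b" "- h *\<^sub>R b"] by simp
  also have "\<dots> = (\<integral>x. (T (- h *\<^sub>R b) (- h *\<^sub>R a) x - T 0 (- h *\<^sub>R a) x
        - T (- h *\<^sub>R b) 0 x + T 0 0 x) / (h * h) \<partial>lborel)"
    by (simp add: iT)
  also have "\<dots> = (\<integral>x. diffquot Z b (- h) x * diffquot \<psi> a (- h) x \<partial>lborel)"
    by (intro Bochner_Integration.integral_cong) (auto simp: diffquot_def T_def field_simps)
  finally show ?thesis .
qed

text \<open>The Jacobian of \<open>(Z, \<psi>)\<close> integrates to zero. Passing to the limit in difference quotients needs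
  only translation invariance, hence no mollification although \<open>Z\<close> and \<open>\<psi>\<close> are merely \<open>C\<^sup>1\<close>.\<close>

lemma integral_jacobian_swap:
  assumes Z: "has_C1_derivative Z Z'" and P: "has_C1_derivative \<psi> \<psi>'"
    and supp: "\<And>x. norm x > R \<Longrightarrow> \<psi> x = 0"
  shows "(\<integral>x. Z' x a * \<psi>' x b \<partial>lborel) = (\<integral>x. Z' x b * \<psi>' x a \<partial>lborel)"
proof -
  define h :: "nat \<Rightarrow> real" where "h n = inverse (real (Suc n))" for n
  have h: "h \<longlonglongrightarrow> 0" "\<And>n. h n \<noteq> 0" "\<And>n. \<bar>h n\<bar> \<le> 1"
    unfolding h_def by (rule LIMSEQ_inverse_real_of_nat) (auto simp: divide_simps)
  have h': "(\<lambda>n. - h n) \<longlonglongrightarrow> 0" using tendsto_minus[OF h(1)] by simp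
  have "(\<lambda>n. \<integral>x. diffquot Z a (h n) x * diffquot \<psi> b (h n) x \<partial>lborel)
           \<longlonglongrightarrow> (\<integral>x. Z' x a * \<psi>' x b \<partial>lborel)"
    by (rule integral_diffquot_tendsto[OF Z P supp h])
  moreover have "(\<lambda>n. \<integral>x. diffquot Z b (- h n) x * diffquot \<psi> a (- h n) x \<partial>lborel)
           \<longlonglongrightarrow> (\<integral>x. Z' x b * \<psi>' x a \<partial>lborel)"
    by (rule integral_diffquot_tendsto[OF Z P supp h']) (use h in auto)
  moreover have "(\<integral>x. diffquot Z a (h n) x * diffquot \<psi> b (h n) x \<partial>lborel)
       = (\<integral>x. diffquot Z b (- h n) x * diffquot \<psi> a (- h n) x \<partial>lborel)" for n
    by (rule integral_diffquot_swap[OF has_C1_derivative_continuous[OF Z]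
          has_C1_derivative_continuous[OF P] supp])
  ultimately show ?thesis by (simp add: LIMSEQ_unique)
qed

section \<open>Cutoff and test functions\<close>

text \<open>A building block for cutoffs that is only \<open>C\<^sup>1\<close>, which is all that is
  asked of test functions here.\<close>

definition hinge_square :: "real \<Rightarrow> real" where
  "hinge_square s = (max 0 s)\<^sup>2"

lemma hinge_square_has_derivative: "(hinge_square has_real_derivative 2 * max 0 s) (at s)"
proof -
  consider "s < 0" | "s = 0" | "s > 0" by linarith
  then show ?thesis
  proof cases
    case 1
    have "((\<lambda>s. 0) has_real_derivative 0) (at s)" by simp
    then have "(hinge_square has_real_derivative 0) (at s)"
      by (rule has_field_derivative_transform_within_open[where S = "{..<0}"])
        (use 1 in \<open>auto simp: hinge_square_def\<close>)
    then show ?thesis using 1 by simp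
  next
    case 2
    have "((\<lambda>h. hinge_square h / h) \<longlongrightarrow> 0) (at 0)"
    proof (rule Lim_null_comparison)
      show "\<forall>\<^sub>F h in at 0. norm (hinge_square h / h) \<le> \<bar>h\<bar>"
        by (intro always_eventually) (auto simp: hinge_square_def power2_eq_square max_def)
      show "((\<lambda>h::real. \<bar>h\<bar>) \<longlongrightarrow> 0) (at 0)" by (auto intro!: tendsto_eq_intros)
    qed
    then show ?thesis using 2 by (simp add: DERIV_def hinge_square_def)
  next
    case 3
    have "((\<lambda>s. s\<^sup>2) has_real_derivative 2 * s) (at s)" by (auto intro!: derivative_eq_intros)
    then have "(hinge_square has_real_derivative 2 * s) (at s)"
      by (rule has_field_derivative_transform_within_open[where S = "{0<..}"])
        (use 3 in \<open>auto simp: hinge_square_def\<close>)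
    then show ?thesis using 3 by simp
  qed
qed

lemma has_C1_derivative_inner_self:
  "has_C1_derivative (\<lambda>x::'a::euclidean_space. x \<bullet> x) (\<lambda>x v. 2 * (x \<bullet> v))"
  unfolding has_C1_derivative_def
  by (auto intro!: derivative_eq_intros continuous_intros simp: inner_commute)

text \<open>The inner hinge vanishes for \<open>t \<le> 1\<close> and is at least 1 for
  \<open>t \<ge> 2\<close>, so the profile falls from 1 to 0 on \<open>[1, 2]\<close>.\<close>

definition cutoff_profile :: "real \<Rightarrow> real" where
  "cutoff_profile t = hinge_square (1 - hinge_square (t - 1))"

definition cutoff_profile_deriv :: "real \<Rightarrow> real" where
  "cutoff_profile_deriv t = 2 * max 0 (1 - hinge_square (t - 1)) * - (2 * max 0 (t - 1))"

lemma cutoff_profile_has_derivative: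
  "(cutoff_profile has_real_derivative cutoff_profile_deriv t) (at t)"
proof -
  have "((\<lambda>t. hinge_square (t - 1)) has_real_derivative 2 * max 0 (t - 1)) (at t)"
    using DERIV_chain2[OF hinge_square_has_derivative DERIV_diff[OF DERIV_ident DERIV_const]] by simp
  from DERIV_chain2[OF hinge_square_has_derivative DERIV_diff[OF DERIV_const this]]
  show ?thesis
    unfolding cutoff_profile_def[abs_def] cutoff_profile_deriv_def by simp
qed

lemma cutoff_profile_bounds: "0 \<le> cutoff_profile t" "cutoff_profile t \<le> 1"
proof -
  have "(max 0 (1 - hinge_square (t - 1)))\<^sup>2 \<le> 1\<^sup>2"
    by (intro power_mono) (auto simp: hinge_square_def)
  then show "0 \<le> cutoff_profile t" "cutoff_profile t \<le> 1"
    by (simp_all add: cutoff_profile_def hinge_square_def)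
qed

lemma cutoff_profile_eq_1: "t \<le> 1 \<Longrightarrow> cutoff_profile t = 1"
  by (simp add: cutoff_profile_def hinge_square_def)

lemma cutoff_profile_eq_0:
  assumes "2 \<le> t"
  shows "cutoff_profile t = 0"
proof -
  have "1\<^sup>2 \<le> (t - 1)\<^sup>2" using assms by (intro power_mono) auto
  then show ?thesis using assms by (simp add: cutoff_profile_def hinge_square_def)
qed

lemma cutoff_profile_deriv_bound: "\<bar>cutoff_profile_deriv t\<bar> \<le> 4"
proof -
  define y where "y = max 0 (t - 1)"
  have y: "0 \<le> y" by (simp add: y_def)
  have "max 0 (1 - y\<^sup>2) * y \<le> 1 * 1"
  proof (cases "y \<le> 1")
    case True
    then show ?thesis using y by (intro mult_mono) auto
  next
    case False
    then have "1\<^sup>2 \<le> y\<^sup>2" by (intro power_mono) auto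
    then show ?thesis by simp
  qed
  moreover have "\<bar>cutoff_profile_deriv t\<bar> = 4 * (max 0 (1 - y\<^sup>2) * y)"
    using y by (simp add: cutoff_profile_deriv_def y_def[symmetric] hinge_square_def abs_mult)
  ultimately show ?thesis by simp
qed

text \<open>The argument is \<open>x \<bullet> x / r\<^sup>2\<close> because the square, unlike the
  norm, is differentiable at the origin.\<close>

definition cutoff :: "real \<Rightarrow> 'a::euclidean_space \<Rightarrow> real" where
  "cutoff r x = cutoff_profile (x \<bullet> x / r\<^sup>2)"

definition cutoff_derivative :: "real \<Rightarrow> 'a::euclidean_space \<Rightarrow> 'a \<Rightarrow> real" where
  "cutoff_derivative r x v = cutoff_profile_deriv (x \<bullet> x / r\<^sup>2) * (1 / r\<^sup>2) * (2 * (x \<bullet> v))"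

lemma cutoff_has_C1_derivative:
  fixes r :: real
  assumes r: "r \<noteq> 0"
  shows "has_C1_derivative (cutoff r) (cutoff_derivative r)"
proof -
  have deriv: "((\<lambda>t. cutoff_profile (t / r\<^sup>2)) has_real_derivative cutoff_profile_deriv (t / r\<^sup>2) * (1 / r\<^sup>2)) (at t)"
    for t
    by (rule DERIV_chain2[OF cutoff_profile_has_derivative DERIV_cdivide[OF DERIV_ident]])
  have cont: "continuous_on UNIV (\<lambda>t. cutoff_profile_deriv (t / r\<^sup>2) * (1 / r\<^sup>2))"
    unfolding cutoff_profile_deriv_def hinge_square_def using r by (intro continuous_intros) auto
  show ?thesis
    unfolding cutoff_def[abs_def] cutoff_derivative_def[abs_def]
    by (rule has_C1_derivative_compose[OF has_C1_derivative_inner_self deriv cont])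
qed

lemma cutoff_bounds: "0 \<le> cutoff r x" "cutoff r x \<le> 1"
  by (simp_all add: cutoff_def cutoff_profile_bounds)

lemma cutoff_inside:
  assumes "0 < r" "norm x \<le> r"
  shows "cutoff r x = 1"
proof -
  have "x \<bullet> x \<le> r\<^sup>2" using assms by (simp add: dot_square_norm power_mono)
  then show ?thesis using assms(1) by (simp add: cutoff_def cutoff_profile_eq_1)
qed

lemma cutoff_outside:
  assumes "0 < r" "norm x > 2 * r"
  shows "cutoff r x = 0"
proof -
  have "(2 * r)\<^sup>2 \<le> (norm x)\<^sup>2" using assms by (intro power_mono) auto
  then have "4 \<le> x \<bullet> x / r\<^sup>2"
    using assms(1) by (simp add: dot_square_norm field_simps)
  then show ?thesis by (simp add: cutoff_def cutoff_profile_eq_0)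
qed

lemma cutoff_derivative_inside:
  assumes "0 < r" "norm x < r"
  shows "cutoff_derivative r x v = 0"
  by (rule has_C1_derivative_const_vanishes[OF cutoff_has_C1_derivative, of _ "ball 0 r" _ 1])
    (use assms in \<open>auto simp: cutoff_inside\<close>)

lemma cutoff_derivative_outside:
  assumes "0 < r" "norm x > 2 * r"
  shows "cutoff_derivative r x v = 0"
  by (rule has_C1_derivative_const_vanishes[OF cutoff_has_C1_derivative, of _ "- cball 0 (2 * r)" _ 0])
    (use assms in \<open>auto simp: cutoff_outside\<close>)

text \<open>The profile contributes 4, differentiating \<open>x \<bullet> x\<close> gives 2, and
  \<open>norm x \<le> 2 * r\<close> on the support. The decay \<open>1 / r\<close> is what makes the
  squared derivative, integrated over a disc of radius \<open>2 * r\<close> in the plane, bounded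
  independently of \<open>r\<close>.\<close>

lemma cutoff_derivative_bound:
  assumes r: "0 < r"
  shows "\<bar>cutoff_derivative r x v\<bar> \<le> 16 * norm v / r"
proof (cases "norm x \<le> 2 * r")
  case True
  have "\<bar>x \<bullet> v\<bar> \<le> norm x * norm v" by (rule Cauchy_Schwarz_ineq2)
  also have "\<dots> \<le> (2 * r) * norm v" using True by (intro mult_right_mono) auto
  finally have "\<bar>cutoff_derivative r x v\<bar> \<le> 4 * (1 / r\<^sup>2) * (2 * (2 * r * norm v))"
    unfolding cutoff_derivative_def abs_mult
    using cutoff_profile_deriv_bound by (intro mult_mono) auto
  also have "\<dots> = 16 * norm v / r" using r by (simp add: power2_eq_square)
  finally show ?thesis .
next
  case False
  then show ?thesis using cutoff_derivative_outside[of r x v] r by simp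
qed

text \<open>The witness \<open>g\<close> grows like the power \<open>s - 1\<close> of
  \<open>|t|\<close>, and \<open>g'\<close> is positive because \<open>s > 1\<close>. The last
  estimate reduces to \<open>(s - 1) * t\<^sup>2 \<le> 1 + (s - 1) * t\<^sup>2\<close>.\<close>

lemma subquadratic_test_function:
  fixes s :: real
  assumes s: "1 < s" "s \<le> 2"
  obtains g g' where "\<And>t. (g has_real_derivative g' t) (at t)" "continuous_on UNIV g'"
    "\<And>t. 0 < g' t" "\<And>t. (s - 1) * (g t)\<^sup>2 \<le> (1 + t\<^sup>2) powr (s / 2) * g' t"
proof -
  define g where "g t = t * (1 + t\<^sup>2) powr (s / 2 - 1)" for t :: real
  define g' where "g' t = (1 + t\<^sup>2) powr (s / 2 - 2) * (1 + (s - 1) * t\<^sup>2)" for t :: real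
  have pos: "0 < 1 + t\<^sup>2" for t :: real by (simp add: add_pos_nonneg)
  have "(g has_real_derivative g' t) (at t)" for t
  proof -
    have "(g has_real_derivative (1 + t\<^sup>2) powr (s / 2 - 1) +
        (s / 2 - 1) * (1 + t\<^sup>2) powr (s / 2 - 1 - 1) * (2 * t) * t) (at t)"
      unfolding g_def using pos[of t] by (auto intro!: derivative_eq_intros simp: algebra_simps)
    moreover have "(1 + t\<^sup>2) powr (s / 2 - 1) = (1 + t\<^sup>2) powr (s / 2 - 2) * (1 + t\<^sup>2)"
      using pos[of t] powr_add[of "1 + t\<^sup>2" "s / 2 - 2" 1] by simp
    ultimately show ?thesis
      by (simp add: g'_def algebra_simps power2_eq_square)
  qed
  moreover have "continuous_on UNIV g'"
    unfolding g'_def using less_imp_neq[OF pos] by (intro continuous_intros) auto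
  moreover have g'_pos: "0 < g' t" for t
    unfolding g'_def using pos[of t] s by (intro mult_pos_pos add_pos_nonneg) auto
  moreover have "(s - 1) * (g t)\<^sup>2 \<le> (1 + t\<^sup>2) powr (s / 2) * g' t" for t
  proof -
    have "(s - 1) * (g t)\<^sup>2 = (s - 1) * t\<^sup>2 * (1 + t\<^sup>2) powr (s - 2)"
      by (simp add: g_def power_mult_distrib power2_eq_square powr_add[symmetric])
    also have "\<dots> \<le> (1 + (s - 1) * t\<^sup>2) * (1 + t\<^sup>2) powr (s - 2)"
      by (intro mult_right_mono) auto
    also have "\<dots> = (1 + t\<^sup>2) powr (s / 2) * g' t"
      by (simp add: g'_def powr_add[symmetric])
    finally show ?thesis .
  qed
  ultimately show ?thesis using that by blast
qed

text \<open>Completing the square in \<open>\<eta> * k * p + \<delta> * m * q\<close>, weighted by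
  \<open>a / (\<delta> * k)\<close>. In use, \<open>a\<close> is a coefficient, \<open>m\<close> and
  \<open>k\<close> are \<open>g (w x)\<close> and \<open>g' (w x)\<close>, and \<open>p\<close>,
  \<open>q\<close> are matching derivatives of \<open>w\<close> and of the cutoff. The left side is
  a cross term of the tested equation, and \<open>am\<close> makes the last term on the right free
  of \<open>w\<close>.\<close>

lemma young_product:
  fixes a b k m \<delta> :: real
  assumes a: "0 \<le> a" and \<delta>: "0 < \<delta>" and k: "0 < k" and am: "a * m\<^sup>2 \<le> \<kappa> * k"
  shows "- (2 * \<eta> * m * (a * p * q)) \<le> (1 / \<delta>) * (\<eta>\<^sup>2 * (k * (a * p\<^sup>2))) + \<delta> * \<kappa> * q\<^sup>2"
proof -
  have "a * m\<^sup>2 / k \<le> \<kappa>" using am k by (simp add: divide_simps)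
  then have "\<delta> * q\<^sup>2 * (a * m\<^sup>2 / k) \<le> \<delta> * q\<^sup>2 * \<kappa>" using \<delta> by (intro mult_left_mono) auto
  moreover have "0 \<le> a / (\<delta> * k) * (\<eta> * k * p + \<delta> * m * q)\<^sup>2" using a \<delta> k by auto
  moreover have "a / (\<delta> * k) * (\<eta> * k * p + \<delta> * m * q)\<^sup>2
      = (1 / \<delta>) * (\<eta>\<^sup>2 * (k * (a * p\<^sup>2))) + 2 * \<eta> * m * (a * p * q) + \<delta> * q\<^sup>2 * (a * m\<^sup>2 / k)"
    using \<delta> k by (simp add: field_simps power2_eq_square)
  ultimately show ?thesis by (simp add: mult_ac)
qed

section \<open>A Liouville theorem in the plane\<close>

text \<open>The equation is tested with \<open>\<eta>\<^sup>2 g(w)\<close>. The free parameter \<open>\<delta>\<close> serves twice: \<open>\<delta> = 2\<close> bounds the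
  energy, \<open>\<delta> \<rightarrow> 0\<close> kills it.\<close>

lemma caccioppoli:
  fixes w :: "'a::euclidean_space \<Rightarrow> real"
  assumes w: "has_C1_derivative w w'"
    and \<alpha>: "continuous_on UNIV \<alpha>" "\<And>x. 0 < \<alpha> x" and \<beta>: "continuous_on UNIV \<beta>" "\<And>x. 0 < \<beta> x"
    and weak: "\<And>\<psi> \<psi>' R. has_C1_derivative \<psi> \<psi>' \<Longrightarrow> (\<And>x. norm x > R \<Longrightarrow> \<psi> x = 0) \<Longrightarrow>
      (\<integral>x. \<alpha> x * w' x e1 * \<psi>' x e1 + \<beta> x * w' x e2 * \<psi>' x e2 \<partial>lborel) = 0"
    and g: "\<And>t. (g has_real_derivative g' t) (at t)" "continuous_on UNIV g'" "\<And>t. 0 < g' t"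
    and \<alpha>g: "\<And>x. \<alpha> x * (g (w x))\<^sup>2 \<le> \<kappa> * g' (w x)" and \<beta>g: "\<And>x. \<beta> x * (g (w x))\<^sup>2 \<le> \<kappa> * g' (w x)"
    and \<eta>: "has_C1_derivative \<eta> \<eta>'" "\<And>x. norm x > R \<Longrightarrow> \<eta> x = 0"
    and A: "A \<in> sets borel" "\<And>x v. x \<notin> A \<Longrightarrow> \<eta>' x v = 0"
    and \<delta>: "0 < \<delta>"
  defines "P \<equiv> \<lambda>x. g' (w x) * (\<alpha> x * (w' x e1)\<^sup>2 + \<beta> x * (w' x e2)\<^sup>2)"
  shows "(\<integral>x. (\<eta> x)\<^sup>2 * P x \<partial>lborel) \<le> (1 / \<delta>) * (\<integral>x. indicator A x * ((\<eta> x)\<^sup>2 * P x) \<partial>lborel)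
      + \<delta> * \<kappa> * (\<integral>x. (\<eta>' x e1)\<^sup>2 + (\<eta>' x e2)\<^sup>2 \<partial>lborel)"
proof -
  have gw: "has_C1_derivative (\<lambda>x. g (w x)) (\<lambda>x v. g' (w x) * w' x v)"
    by (rule has_C1_derivative_compose[OF w g(1,2)])
  have g'w: "continuous_on UNIV (\<lambda>x. g' (w x))"
    using continuous_on_compose2[OF g(2) has_C1_derivative_continuous[OF w]] by simp
  note cont = has_C1_derivative_continuous[OF gw] g'w has_C1_derivativeD(2)[OF w] \<alpha>(1) \<beta>(1)
    has_C1_derivative_continuous[OF \<eta>(1)] has_C1_derivativeD(2)[OF \<eta>(1)]
  have \<eta>'0: "\<eta>' x v = 0" if "norm x > R" for x v
    by (rule has_C1_derivative_const_vanishes[OF \<eta>(1), of "- cball 0 R"]) (use that \<eta>(2) in auto)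
  define \<psi> where "\<psi> x = \<eta> x * \<eta> x * g (w x)" for x
  define \<psi>' where "\<psi>' x v = \<eta> x * \<eta> x * (g' (w x) * w' x v)
      + (\<eta> x * \<eta>' x v + \<eta>' x v * \<eta> x) * g (w x)" for x v
  define W where "W x = \<alpha> x * w' x e1 * \<psi>' x e1 + \<beta> x * w' x e2 * \<psi>' x e2" for x
  have "has_C1_derivative \<psi> \<psi>'"
    unfolding \<psi>_def \<psi>'_def by (intro has_C1_derivative_mult \<eta>(1) gw)
  then have W0: "(\<integral>x. W x \<partial>lborel) = 0"
    unfolding W_def by (rule weak[where R = R]) (simp add: \<psi>_def \<eta>(2))
  have iW: "integrable lborel W"
    unfolding W_def \<psi>'_def
    by (rule integrable_continuous_cball_support[where R = R], intro continuous_intros cont)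
      (simp add: \<eta>(2))
  have iP: "integrable lborel (\<lambda>x. (\<eta> x)\<^sup>2 * P x)"
    unfolding P_def
    by (rule integrable_continuous_cball_support[where R = R], intro continuous_intros cont)
      (simp add: \<eta>(2))
  have iA: "integrable lborel (\<lambda>x. indicator A x * ((\<eta> x)\<^sup>2 * P x))"
    using integrable_mult_indicator[OF _ iP, of A] A(1) by simp
  have iN: "integrable lborel (\<lambda>x. (\<eta>' x e1)\<^sup>2 + (\<eta>' x e2)\<^sup>2)"
    by (rule integrable_continuous_cball_support[where R = R], intro continuous_intros cont)
      (simp add: \<eta>'0)
  \<comment> \<open>\<open>W\<close> is the energy density plus cross terms containing
    \<open>\<eta>'\<close>. On \<open>A\<close> the cross terms are estimated by
    \<open>young_product\<close>; off \<open>A\<close> they vanish, so only the energy on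
    \<open>A\<close> appears with the factor \<open>1 / \<delta>\<close>.\<close>
  have "(\<eta> x)\<^sup>2 * P x \<le> W x + ((1 / \<delta>) * (indicator A x * ((\<eta> x)\<^sup>2 * P x))
      + \<delta> * \<kappa> * ((\<eta>' x e1)\<^sup>2 + (\<eta>' x e2)\<^sup>2))" for x
  proof -
    have W: "W x = (\<eta> x)\<^sup>2 * P x + 2 * \<eta> x * g (w x) * (\<alpha> x * w' x e1 * \<eta>' x e1)
        + 2 * \<eta> x * g (w x) * (\<beta> x * w' x e2 * \<eta>' x e2)"
      by (simp add: W_def \<psi>'_def P_def algebra_simps power2_eq_square)
    show ?thesis
    proof (cases "x \<in> A")
      case True
      have "- (2 * \<eta> x * g (w x) * (\<alpha> x * w' x e1 * \<eta>' x e1))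
          \<le> (1 / \<delta>) * ((\<eta> x)\<^sup>2 * (g' (w x) * (\<alpha> x * (w' x e1)\<^sup>2))) + \<delta> * \<kappa> * (\<eta>' x e1)\<^sup>2"
        by (rule young_product) (use \<alpha>(2) \<delta> g(3) \<alpha>g in \<open>auto intro: less_imp_le\<close>)
      moreover have "- (2 * \<eta> x * g (w x) * (\<beta> x * w' x e2 * \<eta>' x e2))
          \<le> (1 / \<delta>) * ((\<eta> x)\<^sup>2 * (g' (w x) * (\<beta> x * (w' x e2)\<^sup>2))) + \<delta> * \<kappa> * (\<eta>' x e2)\<^sup>2"
        by (rule young_product) (use \<beta>(2) \<delta> g(3) \<beta>g in \<open>auto intro: less_imp_le\<close>)
      moreover have "(1 / \<delta>) * ((\<eta> x)\<^sup>2 * P x) =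
          (1 / \<delta>) * ((\<eta> x)\<^sup>2 * (g' (w x) * (\<alpha> x * (w' x e1)\<^sup>2)))
          + (1 / \<delta>) * ((\<eta> x)\<^sup>2 * (g' (w x) * (\<beta> x * (w' x e2)\<^sup>2)))"
        by (simp only: P_def distrib_left)
      ultimately show ?thesis using True by (simp add: W distrib_left)
    qed (simp add: W A(2))
  qed
  then have "(\<integral>x. (\<eta> x)\<^sup>2 * P x \<partial>lborel) \<le> (\<integral>x. W x + ((1 / \<delta>) * (indicator A x * ((\<eta> x)\<^sup>2 * P x))
      + \<delta> * \<kappa> * ((\<eta>' x e1)\<^sup>2 + (\<eta>' x e2)\<^sup>2)) \<partial>lborel)"
    by (intro Bochner_Integration.integral_mono iP Bochner_Integration.integrable_add integrable_mult_right iW iA iN)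
  also have "\<dots> = (\<integral>x. W x \<partial>lborel) + ((\<integral>x. (1 / \<delta>) * (indicator A x * ((\<eta> x)\<^sup>2 * P x)) \<partial>lborel)
      + (\<integral>x. \<delta> * \<kappa> * ((\<eta>' x e1)\<^sup>2 + (\<eta>' x e2)\<^sup>2) \<partial>lborel))"
    by (subst Bochner_Integration.integral_add
        | intro Bochner_Integration.integrable_add integrable_mult_right iW iA iN | rule refl)+
  finally show ?thesis
    unfolding integral_mult_right_zero W0 by simp
qed

lemma liouville_degenerate_divergence_form:
  fixes w :: "'a::euclidean_space \<Rightarrow> real"
  assumes dim: "DIM('a) = 2" and e: "norm e1 = 1" "norm e2 = 1"
    and w: "has_C1_derivative w w'"
    and \<alpha>: "continuous_on UNIV \<alpha>" "\<And>x. 0 < \<alpha> x" and \<beta>: "continuous_on UNIV \<beta>" "\<And>x. 0 < \<beta> x"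
    and s: "1 < s" "s \<le> 2"
    and \<alpha>K: "\<And>x. \<alpha> x * (1 + (w x)\<^sup>2) powr (s / 2) \<le> K"
    and \<beta>K: "\<And>x. \<beta> x * (1 + (w x)\<^sup>2) powr (s / 2) \<le> K"
    and weak: "\<And>\<psi> \<psi>' R. has_C1_derivative \<psi> \<psi>' \<Longrightarrow> (\<And>x. norm x > R \<Longrightarrow> \<psi> x = 0) \<Longrightarrow>
      (\<integral>x. \<alpha> x * w' x e1 * \<psi>' x e1 + \<beta> x * w' x e2 * \<psi>' x e2 \<partial>lborel) = 0"
  shows "w' x e1 = 0 \<and> w' x e2 = 0"
proof -
  obtain g g' where g: "\<And>t. (g has_real_derivative g' t) (at t)" "continuous_on UNIV g'"
    "\<And>t. 0 < g' t" and gg': "\<And>t. (s - 1) * (g t)\<^sup>2 \<le> (1 + t\<^sup>2) powr (s / 2) * g' t"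
    using subquadratic_test_function[OF s] by blast
  define \<kappa> where "\<kappa> = K / (s - 1)"
  \<comment> \<open>Turns a weighted bound on a coefficient into the hypothesis that
    \<open>caccioppoli\<close> needs; the factor \<open>s - 1\<close> of the test function goes into
    \<open>\<kappa>\<close>.\<close>
  have weight: "a * (g t)\<^sup>2 \<le> \<kappa> * g' t" if "0 < a" "a * (1 + t\<^sup>2) powr (s / 2) \<le> K" for a t
  proof -
    have "a * ((s - 1) * (g t)\<^sup>2) \<le> a * ((1 + t\<^sup>2) powr (s / 2) * g' t)"
      using gg' that by (intro mult_left_mono) auto
    also have "\<dots> \<le> K * g' t"
      using mult_right_mono[OF that(2), of "g' t"] g(3)[of t] by (simp add: mult.assoc)
    finally show ?thesis using s by (simp add: \<kappa>_def field_simps)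
  qed
  have \<kappa>: "0 \<le> \<kappa>"
  proof -
    have "0 \<le> K" using \<alpha>K[of 0] \<alpha>(2)[of 0] by (meson mult_nonneg_nonneg less_imp_le powr_ge_zero order_trans)
    then show ?thesis using s by (simp add: \<kappa>_def)
  qed
  define P where "P x = g' (w x) * (\<alpha> x * (w' x e1)\<^sup>2 + \<beta> x * (w' x e2)\<^sup>2)" for x
  have P0: "0 \<le> P x" for x
    using g(3) \<alpha>(2) \<beta>(2) by (simp add: P_def less_imp_le)
  have "continuous_on UNIV (\<lambda>x. g' (w x))"
    using continuous_on_compose2[OF g(2) has_C1_derivative_continuous[OF w]] by simp
  then have cP: "continuous_on UNIV P"
    unfolding P_def by (intro continuous_intros has_C1_derivativeD(2)[OF w] \<alpha>(1) \<beta>(1))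
  \<comment> \<open>Each squared derivative of the cutoff in a unit direction is at most
    \<open>256 / (r n)\<^sup>2\<close>; two of them over a disc of area
    \<open>unit_ball_vol 2 * (2 * r n)\<^sup>2\<close> give the factor 2048.\<close>
  define S where "S = 2048 * unit_ball_vol 2"
  define r where "r n = real (Suc n)" for n
  have r: "0 < r n" for n by (simp add: r_def)
  define \<eta> :: "nat \<Rightarrow> 'a \<Rightarrow> real" where "\<eta> n = cutoff (r n)" for n
  define \<eta>' :: "nat \<Rightarrow> 'a \<Rightarrow> 'a \<Rightarrow> real" where "\<eta>' n = cutoff_derivative (r n)" for n
  have \<eta>: "has_C1_derivative (\<eta> n) (\<eta>' n)" for n
    unfolding \<eta>_def \<eta>'_def using r[of n] by (intro cutoff_has_C1_derivative) simp
  have \<eta>01: "0 \<le> \<eta> n x \<and> \<eta> n x \<le> 1" for n x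
    by (simp add: \<eta>_def cutoff_bounds)
  have \<eta>1: "norm x \<le> r n \<Longrightarrow> \<eta> n x = 1" and \<eta>0: "norm x > 2 * r n \<Longrightarrow> \<eta> n x = 0" for n x
    by (simp_all add: \<eta>_def cutoff_inside cutoff_outside r)
  have flat: "norm x < r n \<Longrightarrow> \<eta>' n x v = 0" and \<eta>'0: "norm x > 2 * r n \<Longrightarrow> \<eta>' n x v = 0"
    and \<eta>'_le: "\<bar>\<eta>' n x v\<bar> \<le> 16 * norm v / r n" for n x v
    unfolding \<eta>'_def
    by (simp_all only: cutoff_derivative_inside cutoff_derivative_outside cutoff_derivative_bound r)
  have Dir: "(\<integral>x. (\<eta>' n x e1)\<^sup>2 + (\<eta>' n x e2)\<^sup>2 \<partial>lborel) \<le> S" for n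
  proof -
    have sq: "(\<eta>' n x v)\<^sup>2 \<le> 256 / (r n)\<^sup>2" if "norm v = 1" for x v
      using power_mono[OF \<eta>'_le[of n x v] abs_ge_zero, of 2] that by (simp add: power_divide)
    have "(\<integral>x. (\<eta>' n x e1)\<^sup>2 + (\<eta>' n x e2)\<^sup>2 \<partial>lborel)
        \<le> (\<integral>x. indicator (cball (0::'a) (2 * r n)) x * (512 / (r n)\<^sup>2) \<partial>lborel)"
    proof (rule Bochner_Integration.integral_mono)
      show "integrable lborel (\<lambda>x. (\<eta>' n x e1)\<^sup>2 + (\<eta>' n x e2)\<^sup>2)"
        by (rule integrable_continuous_cball_support[where R = "2 * r n"],
            intro continuous_intros has_C1_derivativeD(2)[OF \<eta>]) (simp add: \<eta>'0)
      show "integrable lborel (\<lambda>x::'a. indicator (cball 0 (2 * r n)) x * (512 / (r n)\<^sup>2))"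
        by (intro integrable_mult_left) (auto intro!: emeasure_compact_finite)
      show "(\<eta>' n x e1)\<^sup>2 + (\<eta>' n x e2)\<^sup>2 \<le> indicator (cball 0 (2 * r n)) x * (512 / (r n)\<^sup>2)" for x
        using sq[OF e(1), of x] sq[OF e(2), of x] \<eta>'0[of n x] by (cases "norm x \<le> 2 * r n") auto
    qed
    also have "\<dots> = measure lborel (cball (0::'a) (2 * r n)) * (512 / (r n)\<^sup>2)"
      by simp
    also have "\<dots> = S"
      using r[of n] by (simp add: content_cball dim S_def power_mult_distrib)
    finally show ?thesis .
  qed
  have S0: "0 \<le> S" by (simp add: S_def)
  have cacc: "(\<integral>x. (\<eta> n x)\<^sup>2 * P x \<partial>lborel)
      \<le> (1 / \<delta>) * (\<integral>x. indicator A x * ((\<eta> n x)\<^sup>2 * P x) \<partial>lborel) + \<delta> * \<kappa> * S"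
    if "A \<in> sets borel" "\<And>x v. x \<notin> A \<Longrightarrow> \<eta>' n x v = 0" "0 < \<delta>" for n A \<delta>
  proof -
    have "(\<integral>x. (\<eta> n x)\<^sup>2 * P x \<partial>lborel)
      \<le> (1 / \<delta>) * (\<integral>x. indicator A x * ((\<eta> n x)\<^sup>2 * P x) \<partial>lborel)
        + \<delta> * \<kappa> * (\<integral>x. (\<eta>' n x e1)\<^sup>2 + (\<eta>' n x e2)\<^sup>2 \<partial>lborel)"
      unfolding P_def
      by (rule caccioppoli[OF w \<alpha> \<beta> weak g weight[OF \<alpha>(2) \<alpha>K] weight[OF \<beta>(2) \<beta>K] \<eta> \<eta>0 that])
    also have "\<dots> \<le> (1 / \<delta>) * (\<integral>x. indicator A x * ((\<eta> n x)\<^sup>2 * P x) \<partial>lborel) + \<delta> * \<kappa> * S"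
      using Dir[of n] \<kappa> that(3) by (intro add_left_mono mult_left_mono) auto
    finally show ?thesis .
  qed
  have lim: "(\<lambda>n. (\<eta> n x)\<^sup>2 * P x) \<longlonglongrightarrow> P x" for x
  proof (rule tendsto_eventually)
    obtain N where N: "norm x \<le> real N" using real_arch_simple by blast
    show "\<forall>\<^sub>F n in sequentially. (\<eta> n x)\<^sup>2 * P x = P x"
      using eventually_ge_at_top[of N]
    proof eventually_elim
      case (elim n)
      then have "norm x \<le> r n" using N by (simp add: r_def)
      then show ?case by (simp add: \<eta>1)
    qed
  qed
  have m\<eta>: "(\<lambda>x. (\<eta> n x)\<^sup>2 * P x) \<in> borel_measurable lborel" for n
    using borel_measurable_continuous_onI[OF continuous_on_mult[OF
          continuous_on_power[OF has_C1_derivative_continuous[OF \<eta>]] cP]] by simp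
  have mP: "P \<in> borel_measurable lborel"
    using borel_measurable_continuous_onI[OF cP] by simp
  have i\<eta>: "integrable lborel (\<lambda>x. (\<eta> n x)\<^sup>2 * P x)" for n
    by (rule integrable_continuous_cball_support[where R = "2 * r n"],
        intro continuous_intros has_C1_derivative_continuous[OF \<eta>] cP) (simp add: \<eta>0)
  \<comment> \<open>With \<open>A = UNIV\<close> and \<open>\<delta> = 2\<close> the energy on the
    right is half of the one on the left and is absorbed.\<close>
  have bdd: "(\<integral>x. (\<eta> n x)\<^sup>2 * P x \<partial>lborel) \<le> 4 * \<kappa> * S" for n
    using cacc[of UNIV n 2] by simp
  \<comment> \<open>Fatou's lemma passes the bound, which is uniform in \<open>n\<close>, from the
    truncated energies to \<open>P\<close>.\<close>
  have iP: "integrable lborel P"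
  proof (rule integrableI_bounded[OF mP])
    have "(\<integral>\<^sup>+x. ennreal (norm (P x)) \<partial>lborel)
        = (\<integral>\<^sup>+x. liminf (\<lambda>n. ennreal ((\<eta> n x)\<^sup>2 * P x)) \<partial>lborel)"
      using P0 lim_imp_Liminf[OF _ tendsto_ennrealI[OF lim]] by (intro nn_integral_cong) simp
    also have "\<dots> \<le> liminf (\<lambda>n. \<integral>\<^sup>+x. ennreal ((\<eta> n x)\<^sup>2 * P x) \<partial>lborel)"
      by (intro nn_integral_liminf measurable_compose[OF m\<eta> measurable_ennreal])
    also have "\<dots> \<le> liminf (\<lambda>n. ennreal (4 * \<kappa> * S))"
    proof (intro Liminf_mono always_eventually allI)
      fix n
      have "(\<integral>\<^sup>+x. ennreal ((\<eta> n x)\<^sup>2 * P x) \<partial>lborel) = ennreal (\<integral>x. (\<eta> n x)\<^sup>2 * P x \<partial>lborel)"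
        using P0 by (intro nn_integral_eq_integral i\<eta>) auto
      then show "(\<integral>\<^sup>+x. ennreal ((\<eta> n x)\<^sup>2 * P x) \<partial>lborel) \<le> ennreal (4 * \<kappa> * S)"
        using bdd[of n] by (simp add: ennreal_leI)
    qed
    also have "\<dots> < \<infinity>" by (simp add: Liminf_const)
    finally show "(\<integral>\<^sup>+x. ennreal (norm (P x)) \<partial>lborel) < \<infinity>" .
  qed
  have \<eta>P_le: "(\<eta> n x)\<^sup>2 * P x \<le> P x" for n x
    using \<eta>01[of n x] P0[of x] by (intro mult_left_le_one_le) (auto simp: power_le_one)
  have limI: "(\<lambda>n. \<integral>x. (\<eta> n x)\<^sup>2 * P x \<partial>lborel) \<longlonglongrightarrow> (\<integral>x. P x \<partial>lborel)"
    by (rule integral_dominated_convergence[where w = P])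
      (use mP m\<eta> iP lim P0 \<eta>P_le in \<open>auto simp: abs_mult\<close>)
  \<comment> \<open>\<open>\<eta>' n\<close> vanishes inside the disc of radius \<open>r n\<close>,
    so the complement is admissible in \<open>cacc\<close>; since \<open>P\<close> is integrable,
    its integral there tends to 0.\<close>
  define A where "A n = - ball (0::'a) (r n)" for n
  have limA: "(\<lambda>n. \<integral>x. indicator (A n) x * ((\<eta> n x)\<^sup>2 * P x) \<partial>lborel) \<longlonglongrightarrow> integral\<^sup>L lborel (\<lambda>x::'a. 0)"
  proof (rule integral_dominated_convergence[where w = P])
    show "AE x in lborel. (\<lambda>n. indicator (A n) x * ((\<eta> n x)\<^sup>2 * P x)) \<longlonglongrightarrow> 0"
    proof (rule AE_I2, rule tendsto_eventually)
      fix x :: 'a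
      obtain N where N: "norm x \<le> real N" using real_arch_simple by blast
      show "\<forall>\<^sub>F n in sequentially. indicator (A n) x * ((\<eta> n x)\<^sup>2 * P x) = 0"
        using eventually_ge_at_top[of N]
      proof eventually_elim
        case (elim n)
        then have "norm x < r n" using N by (simp add: r_def)
        then show ?case by (simp add: A_def)
      qed
    qed
    show "(\<lambda>x. indicator (A n) x * ((\<eta> n x)\<^sup>2 * P x)) \<in> borel_measurable lborel" for n
      by (intro borel_measurable_times[OF borel_measurable_indicator m\<eta>]) (simp add: A_def)
    show "AE x in lborel. norm (indicator (A n) x * ((\<eta> n x)\<^sup>2 * P x)) \<le> P x" for n
      using P0 \<eta>P_le by (auto simp: indicator_def abs_mult)
  qed (use iP in auto)
  \<comment> \<open>Order of limits: \<open>n\<close> tends to infinity with \<open>\<delta>\<close>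
    fixed, which removes the tail term despite its factor \<open>1 / \<delta>\<close>; only
    afterwards does \<open>\<delta>\<close> tend to 0.\<close>
  have small: "(\<integral>x. P x \<partial>lborel) \<le> \<delta> * (\<kappa> * S)" if "0 < \<delta>" for \<delta>
  proof (rule LIMSEQ_le[OF limI])
    show "(\<lambda>n. (1 / \<delta>) * (\<integral>x. indicator (A n) x * ((\<eta> n x)\<^sup>2 * P x) \<partial>lborel) + \<delta> * \<kappa> * S)
        \<longlonglongrightarrow> \<delta> * (\<kappa> * S)"
      using limA \<open>0 < \<delta>\<close> by (auto intro!: tendsto_eq_intros)
    show "\<exists>N. \<forall>n\<ge>N. (\<integral>x. (\<eta> n x)\<^sup>2 * P x \<partial>lborel)
        \<le> (1 / \<delta>) * (\<integral>x. indicator (A n) x * ((\<eta> n x)\<^sup>2 * P x) \<partial>lborel) + \<delta> * \<kappa> * S"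
      by (intro exI[of _ 0] allI impI cacc that) (use flat in \<open>auto simp: A_def\<close>)
  qed
  have "(\<integral>x. P x \<partial>lborel) \<le> 0"
  proof (rule tendsto_lowerbound[where F = "at_right (0::real)"])
    show "((\<lambda>\<delta>. \<delta> * (\<kappa> * S)) \<longlongrightarrow> 0) (at_right 0)"
      by (auto intro!: tendsto_eq_intros)
    show "\<forall>\<^sub>F \<delta> in at_right 0. (\<integral>x. P x \<partial>lborel) \<le> \<delta> * (\<kappa> * S)"
      using eventually_at_right_less by eventually_elim (rule small)
  qed simp
  then have "(\<integral>x. P x \<partial>lborel) = 0"
    using P0 by (simp add: Bochner_Integration.integral_nonneg antisym)
  then have "AE x in lborel. P x = 0"
    using integral_nonneg_eq_0_iff_AE[OF iP] P0 by simp
  \<comment> \<open>From almost everywhere to everywhere: by continuity of \<open>P\<close> the set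
    where it differs from 0 is open, and a negligible open set is empty.\<close>
  then have "AE x in lebesgue. P x = 0"
    by (rule AE_completion)
  then have "negligible {x. P x \<noteq> 0}"
    unfolding eventually_ae_filter using negligible_iff_null_sets negligible_subset by auto
  moreover have "open {x. P x \<noteq> 0}"
    using cP by (intro open_Collect_neq continuous_on_const)
  ultimately have "P x = 0" for x
    using open_not_negligible by blast
  then have "\<alpha> x * (w' x e1)\<^sup>2 + \<beta> x * (w' x e2)\<^sup>2 = 0"
    using g(3)[of "w x"] by (metis P_def less_irrefl mult_eq_0_iff)
  then show ?thesis
    using \<alpha>(2)[of x] \<beta>(2)[of x] by (auto simp: add_nonneg_eq_0_iff less_imp_le)
qed

section \<open>Equations of splitting type\<close>

text \<open>The exponents combine to \<open>(s - \<mu>) / 2 \<le> 0\<close> over a base of at least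
  1. This serves the coefficient that depends on the same quantity as the weight.\<close>

lemma weight_bound_self:
  fixes t :: real
  assumes "a \<le> C * (1 + t\<^sup>2) powr (- \<mu> / 2)" and "s \<le> \<mu>" and "0 \<le> C"
  shows "a * (1 + t\<^sup>2) powr (s / 2) \<le> C"
proof -
  define G where "G = 1 + t\<^sup>2"
  have G: "1 \<le> G" by (simp add: G_def)
  have "a * G powr (s / 2) \<le> C * G powr (- \<mu> / 2) * G powr (s / 2)"
    using assms(1) by (intro mult_right_mono) (auto simp: G_def)
  also have "\<dots> = C * G powr ((s - \<mu>) / 2)"
    by (simp add: powr_add[symmetric] diff_divide_distrib)
  also have "\<dots> \<le> C * G powr 0"
    using assms(2,3) G by (intro mult_left_mono powr_mono) auto
  finally show ?thesis using G by (simp add: G_def[symmetric])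
qed

text \<open>The place where balancing enters. With \<open>G = 1 + y\<^sup>2\<close> it gives
  \<open>1 + \<bar>t\<bar> \<le> (1 + 2 * c) * G powr (\<rho> * \<mu> / 2)\<close>. Raised to the
  power \<open>s\<close> this grows at most like \<open>G powr (\<mu> / 2)\<close>, because
  \<open>\<rho> * s \<le> 1\<close>, and the decay of \<open>a\<close> compensates it.\<close>

lemma weight_bound_balanced:
  fixes t y :: real
  assumes a: "a \<le> C * (1 + y\<^sup>2) powr (- \<mu> / 2)" and C: "0 \<le> C"
    and t: "\<bar>t\<bar> \<le> c * (\<bar>y\<bar> powr (\<rho> * \<mu>) + 1)" and c: "0 < c"
    and \<rho>: "0 < \<rho>" "\<rho> * s \<le> 1" and \<mu>: "0 < \<mu>" and s: "0 < s"
  shows "a * (1 + t\<^sup>2) powr (s / 2) \<le> C * (1 + 2 * c) powr s"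
proof -
  define G where "G = 1 + y\<^sup>2"
  have G: "1 \<le> G" by (simp add: G_def)
  have "\<bar>y\<bar> powr (\<rho> * \<mu>) = (y\<^sup>2) powr (\<rho> * \<mu> / 2)"
    using powr_powr[of "\<bar>y\<bar>" 2 "\<rho> * \<mu> / 2"] by (cases "y = 0") (simp_all add: powr_numeral)
  also have "\<dots> \<le> G powr (\<rho> * \<mu> / 2)"
    unfolding G_def using \<rho> \<mu> by (intro powr_mono2) auto
  finally have y: "\<bar>y\<bar> powr (\<rho> * \<mu>) \<le> G powr (\<rho> * \<mu> / 2)" .
  have one: "1 \<le> G powr (\<rho> * \<mu> / 2)"
    using G \<rho> \<mu> by (intro ge_one_powr_ge_zero) auto
  have "c * (\<bar>y\<bar> powr (\<rho> * \<mu>) + 1) \<le> c * (G powr (\<rho> * \<mu> / 2) + G powr (\<rho> * \<mu> / 2))"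
    using y one c by (intro mult_left_mono add_mono) auto
  then have "1 + \<bar>t\<bar> \<le> G powr (\<rho> * \<mu> / 2) + c * (G powr (\<rho> * \<mu> / 2) + G powr (\<rho> * \<mu> / 2))"
    using t one by linarith
  also have "\<dots> = (1 + 2 * c) * G powr (\<rho> * \<mu> / 2)" by (simp add: algebra_simps)
  finally have *: "1 + \<bar>t\<bar> \<le> (1 + 2 * c) * G powr (\<rho> * \<mu> / 2)" .
  have "(1 + t\<^sup>2) powr (s / 2) \<le> ((1 + \<bar>t\<bar>)\<^sup>2) powr (s / 2)"
    using s by (intro powr_mono2) (auto simp: power2_sum)
  also have "\<dots> = (1 + \<bar>t\<bar>) powr s"
    using powr_powr[of "1 + \<bar>t\<bar>" 2 "s / 2"] by (simp add: powr_numeral)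
  also have "\<dots> \<le> ((1 + 2 * c) * G powr (\<rho> * \<mu> / 2)) powr s"
    using * s by (intro powr_mono2) auto
  also have "\<dots> = (1 + 2 * c) powr s * G powr (\<rho> * s * \<mu> / 2)"
    using c by (simp add: powr_mult powr_powr mult_ac)
  finally have "a * (1 + t\<^sup>2) powr (s / 2)
      \<le> (C * G powr (- \<mu> / 2)) * ((1 + 2 * c) powr s * G powr (\<rho> * s * \<mu> / 2))"
    using a C by (intro mult_mono) (auto simp: G_def)
  also have "\<dots> = C * (1 + 2 * c) powr s * G powr ((\<rho> * s - 1) * \<mu> / 2)"
    by (simp add: powr_add[symmetric] field_simps)
  also have "\<dots> \<le> C * (1 + 2 * c) powr s * G powr 0"
  proof (intro mult_left_mono powr_mono)
    show "(\<rho> * s - 1) * \<mu> / 2 \<le> 0"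
      using \<rho>(2) \<mu> by (simp add: mult_nonpos_nonneg)
  qed (use G C in auto)
  also have "\<dots> = C * (1 + 2 * c) powr s" using G by simp
  finally show ?thesis .
qed

text \<open>Stated for a pair \<open>w\<close>, \<open>v\<close>, the two partial derivatives of
  \<open>u\<close> in either order, so that both balancing cases are instances. \<open>curl\<close>
  expresses the symmetry of second derivatives, and \<open>F2\<close> is the first derivative of the
  summand of \<open>f\<close> that belongs to \<open>v\<close>.\<close>

lemma splitting_equation_derivatives_vanish:
  fixes w v :: "'a::euclidean_space \<Rightarrow> real" and a1 a2 F2 :: "real \<Rightarrow> real"
  assumes dim: "DIM('a) = 2" and e: "norm e1 = 1" "norm e2 = 1"
    and w: "has_C1_derivative w w'" and v: "has_C1_derivative v v'"
    and curl: "\<And>x. v' x e1 = w' x e2"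
    and eq: "\<And>x. a1 (w x) * w' x e1 + a2 (v x) * v' x e2 = 0"
    and a1: "continuous_on UNIV a1" "\<And>t. 0 < a1 t" "\<And>t. a1 t \<le> C1 * (1 + t\<^sup>2) powr (- \<mu>1 / 2)"
    and a2: "continuous_on UNIV a2" "\<And>t. 0 < a2 t" "\<And>t. a2 t \<le> C2 * (1 + t\<^sup>2) powr (- \<mu>2 / 2)"
    and F2: "\<And>t. (F2 has_real_derivative a2 t) (at t)"
    and C: "0 < C1" "0 < C2" and \<mu>: "1 < \<mu>1" "1 < \<mu>2"
    and c: "0 < c" and \<rho>: "0 < \<rho>" "\<rho> < 1"
    and bal: "\<And>x. \<bar>w x\<bar> \<le> c * (\<bar>v x\<bar> powr (\<rho> * \<mu>2) + 1)"
  shows "w' x e1 = 0" and "w' x e2 = 0" and "v' x e1 = 0" and "v' x e2 = 0"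
proof -
  \<comment> \<open>An exponent \<open>s > 1\<close> with \<open>s \<le> \<mu>1\<close> and \<open>\<rho> * s \<le> 1\<close> exists because \<open>\<mu>1 > 1\<close> and \<open>\<rho> < 1\<close>.\<close>
  define s where "s = min 2 (min \<mu>1 (1 / \<rho>))"
  have s: "1 < s" "s \<le> 2" "s \<le> \<mu>1" and "s \<le> 1 / \<rho>"
    using \<mu> \<rho> by (auto simp: s_def)
  then have \<rho>s: "\<rho> * s \<le> 1"
    using \<rho> by (simp add: field_simps)
  define K where "K = max C1 (C2 * (1 + 2 * c) powr s)"
  define Z' where "Z' x b = a2 (v x) * v' x b" for x b
  have Z: "has_C1_derivative (\<lambda>x. F2 (v x)) Z'"
    unfolding Z'_def by (rule has_C1_derivative_compose[OF v F2 a2(1)])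
  have "w' x e1 = 0 \<and> w' x e2 = 0" for x
  proof (rule liouville_degenerate_divergence_form[OF dim e w _ _ _ _ s(1,2)])
    show "continuous_on UNIV (\<lambda>x. a1 (w x))" "continuous_on UNIV (\<lambda>x. a2 (v x))"
      using continuous_on_compose2[OF a1(1) has_C1_derivative_continuous[OF w]]
        continuous_on_compose2[OF a2(1) has_C1_derivative_continuous[OF v]] by simp_all
    show "a1 (w x) * (1 + (w x)\<^sup>2) powr (s / 2) \<le> K" for x
      using weight_bound_self[OF a1(3) s(3)] C by (simp add: K_def le_max_iff_disj)
    show "a2 (v x) * (1 + (w x)\<^sup>2) powr (s / 2) \<le> K" for x
      using weight_bound_balanced[OF a2(3) _ bal c \<rho>(1) \<rho>s] C \<mu> s
      by (simp add: K_def le_max_iff_disj)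
    fix \<psi> :: "'a \<Rightarrow> real" and \<psi>' R
    assume P: "has_C1_derivative \<psi> \<psi>'" and supp: "\<And>x. norm x > R \<Longrightarrow> \<psi> x = 0"
    have \<psi>'0: "\<psi>' x b = 0" if "norm x > R" for x b
      by (rule has_C1_derivative_const_vanishes[OF P, of "- cball 0 R"]) (use that supp in auto)
    have int: "integrable lborel (\<lambda>x. Z' x b * \<psi>' x d)" for b d
      by (rule integrable_continuous_cball_support[where R = R],
          intro continuous_intros has_C1_derivativeD(2)[OF Z] has_C1_derivativeD(2)[OF P])
        (simp add: \<psi>'0)
    \<comment> \<open>By \<open>eq\<close> and \<open>curl\<close> the flux with components
      \<open>a1 (w x) * w' x e1\<close> and \<open>a2 (v x) * w' x e2\<close> is the gradient of
      \<open>F2 (v x)\<close> rotated by a right angle, so the integrand is a Jacobian.\<close>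
    have "a1 (w x) * w' x e1 * \<psi>' x e1 + a2 (v x) * w' x e2 * \<psi>' x e2
        = Z' x e1 * \<psi>' x e2 - Z' x e2 * \<psi>' x e1" for x
      using eq[of x] curl[of x] by (simp add: Z'_def eq_neg_iff_add_eq_0[symmetric])
    then show "(\<integral>x. a1 (w x) * w' x e1 * \<psi>' x e1 + a2 (v x) * w' x e2 * \<psi>' x e2 \<partial>lborel) = 0"
      using integral_jacobian_swap[OF Z P supp, where a = e1 and b = e2] int by simp
  qed (use a1(2) a2(2) in auto)
  then show w0: "w' x e1 = 0" "w' x e2 = 0" for x by auto
  show "v' x e1 = 0" using curl w0(2) by simp
  show "v' x e2 = 0" using eq[of x] w0(1)[of x] a2(2)[of "v x"] by simp
qed

section \<open>From the predicates of the statement to explicit derivatives\<close>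

lemma frechet_derivative_real_one:
  fixes g :: "real \<Rightarrow> real"
  assumes "g differentiable (at t)"
  shows "frechet_derivative g (at t) 1 = deriv g t"
proof -
  have "(g has_derivative (*) (deriv g t)) (at t)"
    using assms by (simp add: DERIV_deriv_iff_real_differentiable flip: has_field_derivative_def)
  from frechet_derivative_at[OF this, symmetric] show ?thesis by simp
qed

text \<open>On the reals \<open>Basis\<close> is \<open>{1}\<close>, so each level of
  \<open>C_k\<close> unfolds to the ordinary derivative.\<close>

lemma C_k_2_real:
  fixes g :: "real \<Rightarrow> real"
  assumes "C_k 2 g"
  shows "(g has_real_derivative deriv g t) (at t)"
    and "(deriv g has_real_derivative deriv (deriv g) t) (at t)"
    and "continuous_on UNIV (deriv (deriv g))"
proof -
  have d1: "g differentiable (at t)" and c1: "C_k 1 (\<lambda>x. frechet_derivative g (at x) 1)" for t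
    using assms by (auto simp: numeral_2_eq_2)
  have e1: "(\<lambda>x. frechet_derivative g (at x) 1) = deriv g"
    using frechet_derivative_real_one[OF d1] by auto
  have d2: "deriv g differentiable (at t)"
    and c2: "continuous_on UNIV (\<lambda>x. frechet_derivative (deriv g) (at x) 1)" for t
    using c1 by (auto simp: e1)
  have e2: "(\<lambda>x. frechet_derivative (deriv g) (at x) 1) = deriv (deriv g)"
    using frechet_derivative_real_one[OF d2] by auto
  show "(g has_real_derivative deriv g t) (at t)"
    "(deriv g has_real_derivative deriv (deriv g) t) (at t)"
    using d1 d2 DERIV_deriv_iff_real_differentiable by blast+
  show "continuous_on UNIV (deriv (deriv g))" using c2 unfolding e2 .
qed

text \<open>Continuity is given in the directions of \<open>Basis\<close>; linearity of the
  derivative extends it to every direction.\<close>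

lemma C_k_1_has_C1_derivative:
  assumes "C_k (Suc 0) g"
  shows "has_C1_derivative g (\<lambda>x. frechet_derivative g (at x))"
proof -
  have d: "(g has_derivative frechet_derivative g (at x)) (at x)"
    and c: "\<And>b. b \<in> Basis \<Longrightarrow> continuous_on UNIV (\<lambda>x. frechet_derivative g (at x) b)" for x
    using assms by (auto simp: frechet_derivative_works)
  have "frechet_derivative g (at x) v = (\<Sum>b\<in>Basis. (v \<bullet> b) * frechet_derivative g (at x) b)" for x v
  proof -
    have "linear (frechet_derivative g (at x))"
      using d has_derivative_linear by blast
    then show ?thesis
      using linear_sum[of "frechet_derivative g (at x)" "\<lambda>b. (v \<bullet> b) *\<^sub>R b" Basis]
      by (simp add: euclidean_representation linear_cmul)
  qed
  then have "continuous_on UNIV (\<lambda>x. frechet_derivative g (at x) v)" for v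
    by (rule ssubst[OF ext]) (intro continuous_intros c)
  then show ?thesis using d by (simp add: has_C1_derivative_def)
qed

lemma C_k_Suc_partial_deriv:
  fixes g :: "real ^ 'n::finite \<Rightarrow> real"
  assumes "C_k (Suc k) g"
  shows "C_k k (partial_deriv i g)"
proof -
  have "axis i 1 \<in> (Basis :: (real ^ 'n) set)" by (auto simp: Basis_vec_def)
  then show ?thesis using assms by (auto simp: partial_deriv_def[abs_def])
qed

lemma C_k_Suc_imp_C_k: "C_k (Suc k) g \<Longrightarrow> C_k k g"
proof (induction k arbitrary: g)
  case 0
  then show ?case
    by (simp add: differentiable_imp_continuous_within continuous_on_eq_continuous_at)
next
  case (Suc k)
  then show ?case by simp
qed

lemma partial_deriv_split_sum:
  fixes f :: "real ^ 2 \<Rightarrow> real"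
  assumes f: "\<And>p. f p = f1 (p $ 1) + f2 (p $ 2)"
    and d: "\<And>t. (f1 has_real_derivative D1 t) (at t)" "\<And>t. (f2 has_real_derivative D2 t) (at t)"
  shows "partial_deriv 1 f p = D1 (p $ 1)" and "partial_deriv 2 f p = D2 (p $ 2)"
proof -
  have comp: "((\<lambda>p. g (p $ i)) has_derivative (\<lambda>h. D (p $ i) * h $ i)) (at p)"
    if "\<And>t. (g has_real_derivative D t) (at t)" for g D :: "real \<Rightarrow> real" and i :: 2
  proof -
    have "((\<lambda>p. p $ i) has_derivative (\<lambda>h. h $ i)) (at p)"
      by (rule bounded_linear.has_derivative[OF bounded_linear_vec_nth has_derivative_ident])
    from diff_chain_at[OF this, of g] that[of "p $ i"] show ?thesis
      by (simp add: o_def has_field_derivative_def)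
  qed
  have "f = (\<lambda>p. f1 (p $ 1) + f2 (p $ 2))" using f by auto
  moreover have "((\<lambda>p. f1 (p $ 1) + f2 (p $ 2)) has_derivative
      (\<lambda>h. D1 (p $ 1) * h $ 1 + D2 (p $ 2) * h $ 2)) (at p)"
    by (intro has_derivative_add comp d)
  ultimately have "(f has_derivative (\<lambda>h. D1 (p $ 1) * h $ 1 + D2 (p $ 2) * h $ 2)) (at p)"
    by (simp only:)
  note frechet_derivative_at[OF this, symmetric]
  then show "partial_deriv 1 f p = D1 (p $ 1)" "partial_deriv 2 f p = D2 (p $ 2)"
    by (simp_all add: partial_deriv_def axis_def)
qed

lemma partial_deriv_compose:
  assumes "has_C1_derivative w w'" and "\<And>t. (g has_real_derivative g' t) (at t)"
  shows "partial_deriv i (\<lambda>y. g (w y)) x = g' (w x) * w' x (axis i 1)"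
proof -
  have "(g has_derivative (\<lambda>t. g' (w x) * t)) (at (w x))"
    using assms(2)[of "w x"] by (simp add: has_field_derivative_def)
  from diff_chain_at[OF has_C1_derivativeD(1)[OF assms(1)] this]
  have "((\<lambda>y. g (w y)) has_derivative (\<lambda>h. g' (w x) * w' x h)) (at x)"
    by (simp add: o_def)
  from frechet_derivative_at[OF this, symmetric] show ?thesis
    by (simp add: partial_deriv_def)
qed

section \<open>Functions with constant gradient\<close>

lemma linear_axis_expansion:
  fixes L :: "real ^ 'n::finite \<Rightarrow> real"
  assumes "linear L"
  shows "L h = (\<Sum>i\<in>UNIV. h $ i * L (axis i 1))"
proof -
  have "(\<Sum>i\<in>UNIV. h $ i *\<^sub>R axis i 1) = h"
    using basis_expansion[of h] by (simp add: scalar_mult_eq_scaleR)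
  moreover have "L (\<Sum>i\<in>UNIV. h $ i *\<^sub>R axis i 1) = (\<Sum>i\<in>UNIV. h $ i * L (axis i 1))"
    by (simp add: linear_sum[OF assms] linear_cmul[OF assms])
  ultimately show ?thesis by simp
qed

text \<open>The derivative is \<open>h \<mapsto> a \<bullet> h\<close> at every point, so
  \<open>u x - a \<bullet> x\<close> has derivative zero and is constant.\<close>

lemma affine_if_partial_derivs_constant:
  fixes u :: "real ^ 'n::finite \<Rightarrow> real"
  assumes u: "\<And>x. (u has_derivative u' x) (at x)"
    and part: "\<And>i x. u' x (axis i 1) = u' 0 (axis i 1)"
  shows "\<exists>a b. \<forall>x. u x = a \<bullet> x + b"
proof -
  define a :: "real ^ 'n" where "a = (\<chi> i. u' 0 (axis i 1))"
  have "u' x h = a \<bullet> h" for x h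
  proof -
    have "u' x h = (\<Sum>i\<in>UNIV. h $ i * u' x (axis i 1))"
      by (rule linear_axis_expansion[OF has_derivative_linear[OF u]])
    also have "\<dots> = a \<bullet> h" by (simp add: part[of x] inner_vec_def a_def mult.commute)
    finally show ?thesis .
  qed
  then have "((\<lambda>x. u x - a \<bullet> x) has_derivative (\<lambda>h. 0)) (at x)" for x
    using has_derivative_diff[OF u[of x] has_derivative_inner_right[OF has_derivative_ident, of a]]
    by simp
  then have eq: "u x - a \<bullet> x = u 0 - a \<bullet> 0" for x
    using has_derivative_zero_unique[of UNIV "\<lambda>x. u x - a \<bullet> x"] by blast
  have "u x = a \<bullet> x + (u 0 - a \<bullet> 0)" for x using eq[of x] by linarith
  then show ?thesis by blast
qed

theorem theorem1p7:
  fixes f1 f2 :: "real \<Rightarrow> real"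
    and C1 C2 \<mu>1 \<mu>2 :: real
    and f u :: "real ^ 2 \<Rightarrow> real"
  assumes "C_k 2 f1" and "C_k 2 f2"
    and "C1 > 0" and "C2 > 0"
    and "\<mu>1 > 1" and "\<mu>2 > 1"
    and "\<And>t. 0 < deriv (deriv f1) t \<and> deriv (deriv f1) t \<le> C1 * (1 + t\<^sup>2) powr (- \<mu>1 / 2)"
    and "\<And>t. 0 < deriv (deriv f2) t \<and> deriv (deriv f2) t \<le> C2 * (1 + t\<^sup>2) powr (- \<mu>2 / 2)"
    and "\<And>p. f p = f1 (p $ 1) + f2 (p $ 2)"
    and "C_k 2 u"
    and "\<And>x. divergence (\<lambda>y. grad f (grad u y)) x = 0"
    and "balanced \<mu>1 \<mu>2 u"
  shows "\<exists>(a :: real ^ 2) (b :: real). \<forall>x. u x = a \<bullet> x + b"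
proof -
  define e :: "2 \<Rightarrow> real ^ 2" where "e i = axis i 1" for i
  define u' where "u' x = frechet_derivative u (at x)" for x
  define p where "p i = partial_deriv i u" for i
  define p' where "p' i x = frechet_derivative (p i) (at x)" for i x
  have "C_k (Suc (Suc 0)) u" using assms(10) by (simp add: numeral_2_eq_2)
  then have "C_k (Suc 0) u" and "C_k (Suc 0) (p i)" for i
    using C_k_Suc_imp_C_k C_k_Suc_partial_deriv unfolding p_def by blast+
  then have u: "has_C1_derivative u u'" and p: "has_C1_derivative (p i) (p' i)" for i
    unfolding u'_def[abs_def] p'_def[abs_def] by (simp_all only: C_k_1_has_C1_derivative)
  have u'p: "u' x (e i) = p i x" for i x
    by (simp add: u'_def p_def e_def partial_deriv_def)
  have sym: "p' i x (e j) = p' j x (e i)" for i j x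
    by (rule mixed_second_derivatives_eq[OF u]) (simp_all only: u'p p)
  note f1 = C_k_2_real[OF assms(1)] and f2 = C_k_2_real[OF assms(2)]
  have "grad f q $ 1 = deriv f1 (q $ 1)" "grad f q $ 2 = deriv f2 (q $ 2)" for q
    using partial_deriv_split_sum[OF assms(9) f1(1) f2(1)] by (simp_all add: grad_def)
  \<comment> \<open>The chain rule applied to each component of the flux turns the divergence into
    the pointwise second-order equation.\<close>
  then have eq: "deriv (deriv f1) (p 1 x) * p' 1 x (e 1) + deriv (deriv f2) (p 2 x) * p' 2 x (e 2) = 0"
    for x
    using assms(11)[of x] partial_deriv_compose[OF p f1(2)] partial_deriv_compose[OF p f2(2)]
    by (simp add: divergence_def sum_2 grad_def p_def[symmetric] e_def)
  have norm_e: "norm (e i) = 1" for i by (simp add: e_def)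
  have dim: "DIM(real ^ 2) = 2" by simp
  obtain c \<rho> where c: "0 < c" and \<rho>: "0 < \<rho>" "\<rho> < 1" and
    bal: "(\<forall>x. \<bar>p 1 x\<bar> \<le> c * (\<bar>p 2 x\<bar> powr (\<rho> * \<mu>2) + 1)) \<or>
          (\<forall>x. \<bar>p 2 x\<bar> \<le> c * (\<bar>p 1 x\<bar> powr (\<rho> * \<mu>1) + 1))"
    using assms(12) unfolding balanced_def p_def by auto
  have eq': "deriv (deriv f2) (p 2 x) * p' 2 x (e 2) + deriv (deriv f1) (p 1 x) * p' 1 x (e 1) = 0"
    for x using eq[of x] by simp
  have zero: "p' i x (e j) = 0" for i j x
    using bal
  proof
    assume b: "\<forall>x. \<bar>p 1 x\<bar> \<le> c * (\<bar>p 2 x\<bar> powr (\<rho> * \<mu>2) + 1)"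
    have "p' 1 x (e 1) = 0" "p' 1 x (e 2) = 0" "p' 2 x (e 1) = 0" "p' 2 x (e 2) = 0" for x
      by (rule splitting_equation_derivatives_vanish[where w = "p 1" and v = "p 2" and w' = "p' 1"
            and v' = "p' 2" and ?e1.0 = "e 1" and ?e2.0 = "e 2" and ?a1.0 = "deriv (deriv f1)"
            and ?a2.0 = "deriv (deriv f2)", OF dim norm_e norm_e p p sym eq f1(3) _ _ f2(3) _ _ f2(2)
            assms(3-6) c \<rho>]; use assms(7,8) b in blast)+
    then show ?thesis using exhaust_2[of i] exhaust_2[of j] by auto
  next
    \<comment> \<open>Case (ii) exchanges the coordinates: \<open>p 2\<close> now plays the part of
      \<open>w\<close>, and \<open>eq'\<close> is the equation in the matching order.\<close>
    assume b: "\<forall>x. \<bar>p 2 x\<bar> \<le> c * (\<bar>p 1 x\<bar> powr (\<rho> * \<mu>1) + 1)"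
    have "p' 2 x (e 2) = 0" "p' 2 x (e 1) = 0" "p' 1 x (e 2) = 0" "p' 1 x (e 1) = 0" for x
      by (rule splitting_equation_derivatives_vanish[where w = "p 2" and v = "p 1" and w' = "p' 2"
            and v' = "p' 1" and ?e1.0 = "e 2" and ?e2.0 = "e 1" and ?a1.0 = "deriv (deriv f2)"
            and ?a2.0 = "deriv (deriv f1)", OF dim norm_e norm_e p p sym eq' f2(3) _ _ f1(3) _ _ f1(2)
            assms(4,3,6,5) c \<rho>]; use assms(7,8) b in blast)+
    then show ?thesis using exhaust_2[of i] exhaust_2[of j] by auto
  qed
  \<comment> \<open>Linearity passes from the axes to all directions, so both first partial
    derivatives of \<open>u\<close> are constant.\<close>
  have "p' i x h = 0" for i x h
    using linear_axis_expansion[OF has_derivative_linear[OF has_C1_derivativeD(1)[OF p]], of i x h] zero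
    by (simp add: e_def)
  then have "(p i has_derivative (\<lambda>h. 0)) (at x)" for i x
    using has_C1_derivativeD(1)[OF p, of i x] by presburger
  then have "p i x = p i 0" for i x
    using has_derivative_zero_unique[of UNIV "p i"] by blast
  then show ?thesis
    using affine_if_partial_derivs_constant[OF has_C1_derivativeD(1)[OF u]] u'p
    unfolding e_def by metis
qed

end
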